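(* For a normed space $X$ the following are equivalent: (i) $X$ admits a locally finite tiling by bounded convex bodies; (ii) $X$ admits an equivalent norm that is (VI)-polyhedral and has property ($\Delta$); (iii) $X$ admits an equivalent norm that is (K)-polyhedral and LFC.
   Context: All normed spaces are real. For a normed space $X$, $B_X$ and $S_X$ denote its closed unit ball and unit sphere, and $X^*$ its topological dual. $\operatorname{ext} C$ is the set of extreme points of a convex set $C$. For $x\in S_X$ let $\mathcal D(x)=\{f\in S_{X^*}: f(x)=1\}$. A convex body is a closed convex set with non-empty interior. A tiling of $X$ is a collection of convex bodies that cover $X$ and have mutually disjoint interiors. A tiling is locally finite if each $x\in X$ has a neighbourhood that intersects only finitely many elements of the tiling. A norm has property ($\Delta$) if for every $x\in S_X$ the set $\operatorname{ext}\mathcal D(x)$ is finite. It is (K)-polyhedral if the unit ball of every finite-dimensional subspace of $X$ is a polytope (the convex hull of finitely many points). It is (VI)-polyhedral if every $x\in S_X$ has a neighbourhood $V$ such that for every $y\in V\cap S_X$ the segment $[x,y]$ is contained in $S_X$. A norm $\|\cdot\|$ is LFC (locally depends on finitely many coordinates) if for each $x\in S_X$ there exist a neighbourhood $U$ of $x$ and functionals $f_1,\dots,f_n\in X^*$ such that $\|y\|=\|z\|$ for all $y,z\in U$ with $f_k(y)=f_k(z)$ for all $k=1,\dots,n$. *)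

theory Defs
  imports "HOL-Analysis.Analysis"
begin

definition convex_body :: "'a::real_normed_vector set \<Rightarrow> bool" where
  "convex_body K \<longleftrightarrow> closed K \<and> convex K \<and> interior K \<noteq> {}"

definition tiling :: "'a::real_normed_vector set set \<Rightarrow> bool" where
  "tiling T \<longleftrightarrow> (\<forall>K\<in>T. convex_body K) \<and> \<Union>T = UNIV \<and>
     pairwise (\<lambda>K L. interior K \<inter> interior L = {}) T"

(* Norms other than the one of the type class are plain functions N. The notions below
   that mention open sets or bounded functionals use the topology of the type class norm
   and its dual space; for an equivalent norm N these are the topology and the dual of N. *)

definition equivalent_norm :: "('a::real_normed_vector \<Rightarrow> real) \<Rightarrow> bool" where
  "equivalent_norm N \<longleftrightarrow>
     (\<forall>x. N x = 0 \<longleftrightarrow> x = 0) \<and>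
     (\<forall>c x. N (c *\<^sub>R x) = \<bar>c\<bar> * N x) \<and>
     (\<forall>x y. N (x + y) \<le> N x + N y) \<and>
     (\<exists>a>0. \<exists>b>0. \<forall>x. a * norm x \<le> N x \<and> N x \<le> b * norm x)"

definition unit_ball :: "('a::real_normed_vector \<Rightarrow> real) \<Rightarrow> 'a set" where
  "unit_ball N = {x. N x \<le> 1}"

definition unit_sphere :: "('a::real_normed_vector \<Rightarrow> real) \<Rightarrow> 'a set" where
  "unit_sphere N = {x. N x = 1}"

definition dual_norm :: "('a::real_normed_vector \<Rightarrow> real) \<Rightarrow> ('a \<Rightarrow>\<^sub>L real) \<Rightarrow> real" where
  "dual_norm N f = (SUP x\<in>unit_ball N. \<bar>blinfun_apply f x\<bar>)"

definition support_functionals ::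
    "('a::real_normed_vector \<Rightarrow> real) \<Rightarrow> 'a \<Rightarrow> ('a \<Rightarrow>\<^sub>L real) set" where
  "support_functionals N x = {f \<in> unit_sphere (dual_norm N). blinfun_apply f x = 1}"

definition property_Delta :: "('a::real_normed_vector \<Rightarrow> real) \<Rightarrow> bool" where
  "property_Delta N \<longleftrightarrow>
     (\<forall>x\<in>unit_sphere N. finite {f. f extreme_point_of support_functionals N x})"

definition K_polyhedral :: "('a::real_normed_vector \<Rightarrow> real) \<Rightarrow> bool" where
  "K_polyhedral N \<longleftrightarrow>
     (\<forall>Y. subspace Y \<and> (\<exists>B. finite B \<and> span B = Y) \<longrightarrow> polytope (unit_ball N \<inter> Y))"

definition VI_polyhedral :: "('a::real_normed_vector \<Rightarrow> real) \<Rightarrow> bool" where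
  "VI_polyhedral N \<longleftrightarrow>
     (\<forall>x\<in>unit_sphere N. \<exists>V. open V \<and> x \<in> V \<and>
        (\<forall>y\<in>V \<inter> unit_sphere N. closed_segment x y \<subseteq> unit_sphere N))"

definition LFC :: "('a::real_normed_vector \<Rightarrow> real) \<Rightarrow> bool" where
  "LFC N \<longleftrightarrow>
     (\<forall>x\<in>unit_sphere N. \<exists>U F. open U \<and> x \<in> U \<and> finite (F :: ('a \<Rightarrow>\<^sub>L real) set) \<and>
        (\<forall>y\<in>U. \<forall>z\<in>U. (\<forall>f\<in>F. blinfun_apply f y = blinfun_apply f z) \<longrightarrow> N y = N z))"

end

theory Submission imports Defs begin

text \<open>
  All three conditions say that some equivalent norm \<open>N\<close> is, near each point of its unit sphere, the
  maximum of finitely many continuous linear functionals. Such norms are called \<open>locally_max\<close> below.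
  For a single equivalent norm, \<open>locally_max\<close> is equivalent to (VI)-polyhedrality with property
  \<open>\<Delta>\<close>, and also to (K)-polyhedrality with LFC; tilings are related to it by passing from a tile
  to a norm and back.

  A \<open>locally_max\<close> norm has all four properties. If \<open>N\<close> is the maximum of
  \<open>f\<^sub>1, \<dots>, f\<^sub>n\<close> near \<open>x\<close>, with all \<open>f\<^sub>i x = 1\<close>, then
  a nearby \<open>y\<close> on the sphere has \<open>f\<^sub>i y = 1\<close> for some \<open>i\<close>, so that
  \<open>f\<^sub>i\<close> supports the whole segment from \<open>x\<close> to \<open>y\<close>; the Farkas lemma
  shows that the support functionals at \<open>x\<close> are the convex combinations of the
  \<open>f\<^sub>i\<close>; LFC is immediate; and the compact sphere of a finite-dimensional subspace needs only
  finitely many functionals.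

  Conversely, let \<open>N\<close> have (VI) and \<open>\<Delta>\<close>. For \<open>y\<close> on the sphere near
  \<open>x\<close> the midpoint of \<open>x\<close> and \<open>y\<close> has norm one, so a functional in the dual
  ball that norms \<open>x + y\<close> norms both \<open>x\<close> and \<open>y\<close>. By
  \<open>Hahn_Banach_extreme\<close> it can be chosen extreme in the dual ball, and then it is one of the finitely
  many extreme points of \<open>\<D>(x)\<close>. If \<open>N\<close> is (K)-polyhedral and depends only on
  \<open>f\<^sub>1, \<dots>, f\<^sub>n\<close> near \<open>x\<close>, then functionals norming points near
  \<open>x\<close> lie in the span of the \<open>f\<^sub>i\<close>. On a finite-dimensional subspace that contains
  \<open>x\<close> and separates this span, the unit ball is the convex hull of a finite set; its polar in the span
  is given by finitely many inequalities and hence again a polytope, and those vertices that take the value one at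
  \<open>x\<close> are the functionals wanted.

  Every tile of a locally finite tiling is, near each point, cut out by finitely many half-spaces: separate it from
  the other tiles nearby. Intersect one bounded tile with its reflection in an interior point; the result is the
  unit ball of a \<open>locally_max\<close> norm. In the other direction, if \<open>N\<close> is
  \<open>locally_max\<close>, each functional \<open>f \<le> N\<close> determines a convex cone
  \<open>{z. f z = N z}\<close>; the cones with non-empty interior cover the space and are locally finite away from
  the origin. Cutting them into the layers \<open>n \<le> N z \<le> n + 1\<close> for \<open>n \<ge> 1\<close> and
  adding the unit ball gives the tiling.
\<close>

section \<open>Extreme functionals below a sublinear functional\<close>

definition sublinear :: "('a::real_vector \<Rightarrow> real) \<Rightarrow> bool" where
  "sublinear p \<longleftrightarrow> (\<forall>x y. p (x + y) \<le> p x + p y) \<and> (\<forall>c x. 0 \<le> c \<longrightarrow> p (c *\<^sub>R x) = c * p x)"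

lemma sublinear_add: "sublinear p \<Longrightarrow> p (x + y) \<le> p x + p y"
  and sublinear_scale: "sublinear p \<Longrightarrow> 0 \<le> c \<Longrightarrow> p (c *\<^sub>R x) = c * p x"
  by (auto simp: sublinear_def)

lemma sublinear_zero: "sublinear p \<Longrightarrow> p 0 = 0"
  using sublinear_scale[of p 0 0] by simp

lemma sublinear_minus: "sublinear p \<Longrightarrow> - p (- x) \<le> p x"
  using sublinear_add[of p x "- x"] sublinear_zero[of p] by simp

text \<open>Sublinear functionals \<open>q\<close> stand in for weak* closed faces of the set of linear functionals
  below \<open>p\<close>: the face consists of the linear functionals below \<open>q\<close>. In this form Zorn's
  lemma applies to faces without any compactness argument.\<close>
definition face_minorants :: "('a::real_vector \<Rightarrow> real) \<Rightarrow> ('a \<Rightarrow> real) \<Rightarrow> bool" where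
  "face_minorants p q \<longleftrightarrow>
     (\<forall>f g t. linear f \<and> linear g \<and> f \<le> p \<and> g \<le> p \<and> 0 < t \<and> t < 1 \<and>
        (\<lambda>x. (1 - t) * f x + t * g x) \<le> q \<longrightarrow> f \<le> q \<and> g \<le> q)"

text \<open>The directional derivative of \<open>p\<close> at \<open>z\<close>, in a form that needs no limit: the
  difference quotients \<open>(p (z + s *\<^sub>R u) - p z) / s\<close> decrease as \<open>s = 1 / t\<close> tends
  to \<open>0\<close>. It is the sublinear functional whose linear minorants are those minorants of
  \<open>p\<close> that agree with \<open>p\<close> at \<open>z\<close>.\<close>
definition tighten :: "('a::real_vector \<Rightarrow> real) \<Rightarrow> 'a \<Rightarrow> 'a \<Rightarrow> real" where
  "tighten p z u = (INF t\<in>{0..}. p (u + t *\<^sub>R z) - t * p z)"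

lemma tighten_lower:
  assumes "sublinear p" "0 \<le> t"
  shows "- p (- u) \<le> p (u + t *\<^sub>R z) - t * p z"
  using sublinear_add[OF assms(1), of "u + t *\<^sub>R z" "- u"] sublinear_scale[OF assms, of z] by simp

lemma tighten_le:
  assumes "sublinear p" "0 \<le> t"
  shows "tighten p z u \<le> p (u + t *\<^sub>R z) - t * p z"
  unfolding tighten_def
  by (rule cINF_lower) (use assms tighten_lower[OF assms(1)] in \<open>auto intro!: bdd_belowI2\<close>)

lemma tighten_greatest:
  assumes "\<And>t. 0 \<le> t \<Longrightarrow> c \<le> p (u + t *\<^sub>R z) - t * p z"
  shows "c \<le> tighten p z u"
  unfolding tighten_def by (rule cINF_greatest) (use assms in auto)

lemma tighten_le_self: "sublinear p \<Longrightarrow> tighten p z \<le> p"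
  using tighten_le[of p 0 z] by (auto simp: le_fun_def)

lemma tighten_uminus: "sublinear p \<Longrightarrow> tighten p z (- z) \<le> - p z"
  using tighten_le[of p 1 z "- z"] sublinear_zero[of p] by simp

lemma sublinear_tighten:
  assumes p: "sublinear p"
  shows "sublinear (tighten p z)"
  unfolding sublinear_def
proof (intro conjI allI impI)
  fix x y
  have "tighten p z (x + y) - tighten p z x \<le> tighten p z y"
  proof (rule tighten_greatest)
    fix t :: real assume t: "0 \<le> t"
    have "tighten p z (x + y) - (p (y + t *\<^sub>R z) - t * p z) \<le> tighten p z x"
    proof (rule tighten_greatest)
      fix s :: real assume s: "0 \<le> s"
      have "tighten p z (x + y) \<le> p ((x + y) + (s + t) *\<^sub>R z) - (s + t) * p z"
        using s t by (intro tighten_le[OF p]) auto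
      moreover have "p ((x + y) + (s + t) *\<^sub>R z) \<le> p (x + s *\<^sub>R z) + p (y + t *\<^sub>R z)"
        using sublinear_add[OF p, of "x + s *\<^sub>R z" "y + t *\<^sub>R z"] by (simp add: algebra_simps)
      ultimately show "tighten p z (x + y) - (p (y + t *\<^sub>R z) - t * p z) \<le> p (x + s *\<^sub>R z) - s * p z"
        by (simp add: algebra_simps)
    qed
    then show "tighten p z (x + y) - tighten p z x \<le> p (y + t *\<^sub>R z) - t * p z" by simp
  qed
  then show "tighten p z (x + y) \<le> tighten p z x + tighten p z y" by simp
next
  have le: "tighten p z (c *\<^sub>R x) \<le> c * tighten p z x" if c: "0 < c" for c x
  proof -
    have "tighten p z (c *\<^sub>R x) / c \<le> tighten p z x"
    proof (rule tighten_greatest)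
      fix t :: real assume t: "0 \<le> t"
      have "tighten p z (c *\<^sub>R x) \<le> p (c *\<^sub>R x + (c * t) *\<^sub>R z) - (c * t) * p z"
        using c t by (intro tighten_le[OF p]) auto
      also have "p (c *\<^sub>R x + (c * t) *\<^sub>R z) = c * p (x + t *\<^sub>R z)"
        using sublinear_scale[OF p, of c "x + t *\<^sub>R z"] c by (simp add: algebra_simps)
      finally show "tighten p z (c *\<^sub>R x) / c \<le> p (x + t *\<^sub>R z) - t * p z"
        using c by (simp add: field_simps)
    qed
    then show ?thesis using c by (simp add: field_simps)
  qed
  fix c :: real and x assume "0 \<le> c"
  show "tighten p z (c *\<^sub>R x) = c * tighten p z x"
  proof (cases "c = 0")
    case True
    have "0 \<le> tighten p z 0"
      using sublinear_scale[OF p, of _ z] by (intro tighten_greatest) auto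
    moreover have "tighten p z 0 \<le> 0"
      using tighten_le[OF p, of 0 z 0] sublinear_zero[OF p] by simp
    ultimately show ?thesis using True by simp
  next
    case False
    with \<open>0 \<le> c\<close> have c: "0 < c" by simp
    have "tighten p z ((1/c) *\<^sub>R (c *\<^sub>R x)) \<le> (1/c) * tighten p z (c *\<^sub>R x)"
      using c by (intro le) auto
    then have "c * tighten p z x \<le> tighten p z (c *\<^sub>R x)"
      using c by (simp add: field_simps)
    with le[OF c, of x] show ?thesis by simp
  qed
qed

lemma linear_le_tighten_iff:
  assumes p: "sublinear p" and f: "linear f"
  shows "f \<le> tighten p z \<longleftrightarrow> f \<le> p \<and> f z = p z"
proof
  assume *: "f \<le> tighten p z"
  then have "f \<le> p" using tighten_le_self[OF p, of z] by (rule order_trans)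
  moreover have "f (- z) \<le> - p z"
    using * tighten_uminus[OF p, of z] unfolding le_fun_def by (blast intro: order_trans)
  ultimately show "f \<le> p \<and> f z = p z"
    using linear_neg[OF f, of z] by (auto simp: le_fun_def intro: antisym)
next
  assume *: "f \<le> p \<and> f z = p z"
  show "f \<le> tighten p z"
    unfolding le_fun_def
  proof (intro allI tighten_greatest)
    fix u and t :: real
    have "f (u + t *\<^sub>R z) \<le> p (u + t *\<^sub>R z)" using * by (simp add: le_fun_def)
    then show "f u \<le> p (u + t *\<^sub>R z) - t * p z"
      using * by (simp add: linear_add[OF f] linear_scale[OF f])
  qed
qed

text \<open>Agreement with \<open>q\<close> at \<open>z\<close> means that evaluation at \<open>z\<close> attains
  its largest possible value, which cuts out a face; and a face of a face is a face.\<close>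
lemma face_minorants_tighten:
  assumes q: "sublinear q" and face: "face_minorants p q"
  shows "face_minorants p (tighten q z)"
  unfolding face_minorants_def
proof (intro allI impI, elim conjE)
  fix f g and t :: real
  assume f: "linear f" and g: "linear g" and le: "f \<le> p" "g \<le> p" and t: "0 < t" "t < 1"
    and h: "(\<lambda>x. (1 - t) * f x + t * g x) \<le> tighten q z"
  have "linear (\<lambda>x. (1 - t) * f x + t * g x)"
    using linear_compose_add[OF linear_compose_scale_right[OF f, of "1 - t"] linear_compose_scale_right[OF g, of t]]
    by simp
  with h have hq: "(\<lambda>x. (1 - t) * f x + t * g x) \<le> q" and hz: "(1 - t) * f z + t * g z = q z"
    using linear_le_tighten_iff[OF q] by auto
  have fg: "f \<le> q" "g \<le> q"
    using face f g le t hq unfolding face_minorants_def by blast+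
  then have d: "0 \<le> q z - f z" "0 \<le> q z - g z" by (auto simp: le_fun_def)
  have "(1 - t) * (q z - f z) + t * (q z - g z) = 0"
    using hz by (simp add: algebra_simps)
  moreover have "0 \<le> (1 - t) * (q z - f z)" "0 \<le> t * (q z - g z)" using d t by auto
  ultimately have "(1 - t) * (q z - f z) = 0" "t * (q z - g z) = 0" by linarith+
  then have "f z = q z" "g z = q z" using t by auto
  with fg show "f \<le> tighten q z \<and> g \<le> tighten q z"
    using linear_le_tighten_iff[OF q] f g by blast
qed

text \<open>Two members of the chain are both bounded below by the smaller of them, which makes the infimum
  subadditive; the lower bound \<open>l\<close> keeps the infimum finite.\<close>
lemma sublinear_INF_chain:
  assumes ne: "C \<noteq> {}" and sub: "\<And>q. q \<in> C \<Longrightarrow> sublinear q"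
    and chain: "\<And>q r. q \<in> C \<Longrightarrow> r \<in> C \<Longrightarrow> q \<le> r \<or> r \<le> q"
    and low: "\<And>q x. q \<in> C \<Longrightarrow> l x \<le> q x"
  shows "sublinear (\<lambda>x. INF q\<in>C. q x)"
  unfolding sublinear_def
proof (intro conjI allI impI)
  have bdd: "bdd_below ((\<lambda>q. q x) ` C)" for x
    using low by (intro bdd_belowI2[of _ "l x"]) auto
  note lower = cINF_lower[OF bdd]
  fix x y
  have "(INF q\<in>C. q (x + y)) - (INF q\<in>C. q x) \<le> (INF q\<in>C. q y)"
  proof (rule cINF_greatest[OF ne])
    fix r assume r: "r \<in> C"
    have "(INF q\<in>C. q (x + y)) - r y \<le> (INF q\<in>C. q x)"
    proof (rule cINF_greatest[OF ne])
      fix q assume q: "q \<in> C"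
      obtain k where k: "k \<in> C" "k \<le> q" "k \<le> r"
        using chain[OF q r] q r by blast
      have "(INF q\<in>C. q (x + y)) \<le> k (x + y)" using k by (intro lower)
      also have "\<dots> \<le> k x + k y" using sublinear_add sub k by blast
      also have "\<dots> \<le> q x + r y" using k by (intro add_mono) (auto simp: le_fun_def)
      finally show "(INF q\<in>C. q (x + y)) - r y \<le> q x" by simp
    qed
    then show "(INF q\<in>C. q (x + y)) - (INF q\<in>C. q x) \<le> r y" by simp
  qed
  then show "(INF q\<in>C. q (x + y)) \<le> (INF q\<in>C. q x) + (INF q\<in>C. q y)" by simp
next
  fix c :: real and x assume c: "0 \<le> c"
  have bdd: "bdd_below ((\<lambda>q. q x) ` C)" for x
    using low by (intro bdd_belowI2[of _ "l x"]) auto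
  note lower = cINF_lower[OF bdd]
  have eq: "(INF q\<in>C. q (c *\<^sub>R x)) = (INF q\<in>C. c * q x)"
    using sublinear_scale[OF sub c] by (intro INF_cong) auto
  show "(INF q\<in>C. q (c *\<^sub>R x)) = c * (INF q\<in>C. q x)"
  proof (cases "c = 0")
    case True
    then show ?thesis using eq ne by simp
  next
    case False
    with c have c: "0 < c" by simp
    show ?thesis
    proof (rule antisym)
      have "(INF q\<in>C. q (c *\<^sub>R x)) / c \<le> (INF q\<in>C. q x)"
      proof (rule cINF_greatest[OF ne])
        fix q assume q: "q \<in> C"
        have "(INF q\<in>C. q (c *\<^sub>R x)) \<le> q (c *\<^sub>R x)" using q by (rule lower)
        also have "\<dots> = c * q x" using c sub[OF q] by (simp add: sublinear_scale)
        finally show "(INF q\<in>C. q (c *\<^sub>R x)) / c \<le> q x" using c by (simp add: field_simps)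
      qed
      then show "(INF q\<in>C. q (c *\<^sub>R x)) \<le> c * (INF q\<in>C. q x)"
        using c by (simp add: field_simps)
      show "c * (INF q\<in>C. q x) \<le> (INF q\<in>C. q (c *\<^sub>R x))"
        unfolding eq using c by (intro cINF_greatest[OF ne] mult_left_mono lower) auto
    qed
  qed
qed

lemma linear_if_sublinear_odd:
  assumes q: "sublinear q" and odd: "\<And>z. q (- z) \<le> - q z"
  shows "linear q"
proof (rule linearI)
  have neg: "q (- z) = - q z" for z
    using odd[of z] sublinear_minus[OF q, of "- z"] by simp
  show "q (x + y) = q x + q y" for x y
    using sublinear_add[OF q, of x y] sublinear_add[OF q, of "- x" "- y"] neg[of x] neg[of y] neg[of "x + y"]
    by simp
  show "q (c *\<^sub>R x) = c *\<^sub>R q x" for c x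
  proof (cases "0 \<le> c")
    case False
    then have "q ((- c) *\<^sub>R (- x)) = (- c) * q (- x)" by (intro sublinear_scale[OF q]) simp
    then show ?thesis using neg by simp
  qed (simp add: sublinear_scale[OF q])
qed

lemma linear_le_linear_eq:
  fixes f g :: "'a::real_vector \<Rightarrow> real"
  assumes "linear f" "linear g" "f \<le> g"
  shows "f = g"
proof
  fix x
  show "f x = g x"
    using assms(3) linear_neg[OF assms(1), of x] linear_neg[OF assms(2), of x]
    by (metis antisym le_funD neg_le_iff_le)
qed

text \<open>The Hahn-Banach theorem, the existence of a supporting functional and the Krein-Milman theorem in one.
  A minimal sublinear functional whose minorants form a face of the minorants of \<open>p\<close> cannot be
  tightened in any direction, so it is odd and therefore linear; it is then its only linear minorant, that is, the
  face is an extreme point. Starting below \<open>tighten p m\<close> forces the value at \<open>m\<close>.\<close>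
theorem Hahn_Banach_extreme:
  fixes p :: "'a::real_vector \<Rightarrow> real"
  assumes p: "sublinear p"
  obtains f where "linear f" "f \<le> p" "f m = p m"
    "\<And>g h t. linear g \<Longrightarrow> linear h \<Longrightarrow> g \<le> p \<Longrightarrow> h \<le> p \<Longrightarrow> 0 < t \<Longrightarrow> t < 1 \<Longrightarrow>
       f = (\<lambda>x. (1 - t) * g x + t * h x) \<Longrightarrow> g = f \<and> h = f"
proof -
  define Q where "Q = {q. sublinear q \<and> q \<le> tighten p m \<and> face_minorants p q}"
  have tight_Q: "tighten q z \<in> Q" if "q \<in> Q" for q z
    using that sublinear_tighten[of q z] face_minorants_tighten[of q p z] tighten_le_self[of q z]
    unfolding Q_def by (auto intro: order_trans)
  have "face_minorants p p" by (auto simp: face_minorants_def)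
  then have start: "tighten p m \<in> Q"
    unfolding Q_def using p by (auto intro: sublinear_tighten face_minorants_tighten)
  have "\<exists>q\<in>Q. \<forall>r\<in>Q. r \<le> q \<longrightarrow> r = q"
  proof (rule predicate_Zorn)
    show "partial_order_on Q (relation_of (\<lambda>x y. y \<le> x) Q)"
      by (rule partial_order_on_relation_ofI) auto
    fix C assume C: "C \<in> Chains (relation_of (\<lambda>x y. y \<le> x) Q)"
    then have CQ: "C \<subseteq> Q" and chain: "\<And>q r. q \<in> C \<Longrightarrow> r \<in> C \<Longrightarrow> q \<le> r \<or> r \<le> q"
      unfolding Chains_def relation_of_def by blast+
    show "\<exists>u\<in>Q. \<forall>q\<in>C. u \<le> q"
    proof (cases "C = {}")
      case True
      then show ?thesis using start by blast
    next
      case ne: False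
      define u where "u = (\<lambda>x. INF q\<in>C. q x)"
      have low: "- p (- x) \<le> q x" if "q \<in> C" for q x
      proof -
        have "sublinear q" "q (- x) \<le> tighten p m (- x)" using that CQ by (auto simp: Q_def le_fun_def)
        moreover have "tighten p m (- x) \<le> p (- x)" using tighten_le_self[OF p] by (simp add: le_fun_def)
        ultimately show ?thesis using sublinear_minus[of q x] by linarith
      qed
      have bdd: "bdd_below ((\<lambda>q. q x) ` C)" for x
        using low by (intro bdd_belowI2[of _ "- p (- x)"]) auto
      have u_le: "u \<le> q" if "q \<in> C" for q
        unfolding u_def le_fun_def using that by (intro allI cINF_lower[OF bdd])
      have le_u: "f \<le> u" if "\<And>q. q \<in> C \<Longrightarrow> f \<le> q" for f
        unfolding u_def le_fun_def using that by (intro allI cINF_greatest[OF ne]) (auto simp: le_fun_def)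
      have "sublinear u"
        unfolding u_def using CQ chain low
        by (intro sublinear_INF_chain[OF ne, where l = "\<lambda>x. - p (- x)"]) (auto simp: Q_def)
      moreover have "u \<le> tighten p m"
        using ne CQ u_le by (force simp: Q_def intro: order_trans)
      moreover have "face_minorants p u"
        unfolding face_minorants_def
      proof (intro allI impI, elim conjE)
        fix f g and t :: real
        assume *: "linear f" "linear g" "f \<le> p" "g \<le> p" "0 < t" "t < 1"
          "(\<lambda>x. (1 - t) * f x + t * g x) \<le> u"
        have "f \<le> q \<and> g \<le> q" if "q \<in> C" for q
        proof -
          have "(\<lambda>x. (1 - t) * f x + t * g x) \<le> q"
            using *(7) u_le[OF that] by (rule order_trans)
          with * that CQ show ?thesis unfolding Q_def face_minorants_def by blast
        qed
        then show "f \<le> u \<and> g \<le> u" using le_u by blast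
      qed
      ultimately have "u \<in> Q" by (simp add: Q_def)
      then show ?thesis using u_le by blast
    qed
  qed
  then obtain q where qQ: "q \<in> Q" and min: "\<And>r. r \<in> Q \<Longrightarrow> r \<le> q \<Longrightarrow> r = q" by blast
  then have q: "sublinear q" and qm: "q \<le> tighten p m" and face: "face_minorants p q"
    by (auto simp: Q_def)
  have "tighten q z = q" for z
    using min[OF tight_Q[OF qQ] tighten_le_self[OF q]] .
  then have lin: "linear q"
    using tighten_uminus[OF q] by (intro linear_if_sublinear_odd[OF q]) metis
  have qp: "q \<le> p \<and> q m = p m"
    using linear_le_tighten_iff[OF p lin] qm by blast
  show thesis
  proof (rule that[of q])
    fix g h and t :: real
    assume *: "linear g" "linear h" "g \<le> p" "h \<le> p" "0 < t" "t < 1"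
      and eq: "q = (\<lambda>x. (1 - t) * g x + t * h x)"
    have "g \<le> q \<and> h \<le> q"
      using face * eq unfolding face_minorants_def by blast
    then show "g = q \<and> h = q" using * lin linear_le_linear_eq by blast
  qed (use lin qp in auto)
qed

section \<open>Finite families of functionals\<close>

text \<open>Induction on the number of functionals. If the hypothesis fails without \<open>a j\<close>, it fails at
  a point \<open>z\<close> that can be scaled to \<open>a j z = 1\<close>; projecting along \<open>z\<close> onto
  the kernel of \<open>a j\<close> eliminates \<open>a j\<close>, and the sign of the other functionals at
  \<open>z\<close> makes the coefficient of \<open>a j\<close> nonnegative.\<close>
lemma Farkas:
  fixes a :: "'i \<Rightarrow> 'a::real_normed_vector \<Rightarrow>\<^sub>L real" and g :: "'a \<Rightarrow>\<^sub>L real"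
  assumes "finite I" "\<And>x. (\<And>i. i \<in> I \<Longrightarrow> a i x \<le> 0) \<Longrightarrow> g x \<le> 0"
  shows "\<exists>c. (\<forall>i\<in>I. 0 \<le> c i) \<and> g = (\<Sum>i\<in>I. c i *\<^sub>R a i)"
  using assms
proof (induction I arbitrary: a g rule: finite_induct)
  case empty
  have "g x = 0" for x
    using empty[of x] empty[of "- x"] by (simp add: blinfun.minus_right)
  then show ?case by (simp add: blinfun_eqI)
next
  case (insert j I)
  show ?case
  proof (cases "\<forall>x. (\<forall>i\<in>I. a i x \<le> 0) \<longrightarrow> g x \<le> 0")
    case True
    then obtain c where c: "\<forall>i\<in>I. 0 \<le> c i" "g = (\<Sum>i\<in>I. c i *\<^sub>R a i)"
      using insert.IH[of a g] by blast
    have "(\<Sum>i\<in>insert j I. (c(j := 0)) i *\<^sub>R a i) = (\<Sum>i\<in>I. c i *\<^sub>R a i)"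
      using insert.hyps by (auto intro!: sum.cong)
    with c show ?thesis by (intro exI[of _ "c(j := 0)"]) auto
  next
    case False
    then obtain w where w: "\<forall>i\<in>I. a i w \<le> 0" "0 < g w" by force
    then have jw: "0 < a j w" using insert.prems[of w] by force
    define z where "z = w /\<^sub>R a j w"
    have jz: "a j z = 1" using jw by (simp add: z_def blinfun.scaleR_right)
    have z: "\<And>i. i \<in> I \<Longrightarrow> a i z \<le> 0" and gz: "0 < g z"
      using w jw by (auto simp: z_def blinfun.scaleR_right mult_le_0_iff)
    have "\<exists>c. (\<forall>i\<in>I. 0 \<le> c i) \<and> g - g z *\<^sub>R a j = (\<Sum>i\<in>I. c i *\<^sub>R (a i - a i z *\<^sub>R a j))"
    proof (rule insert.IH)
      fix x assume x: "\<And>i. i \<in> I \<Longrightarrow> (a i - a i z *\<^sub>R a j) x \<le> 0"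
      have "g (x - a j x *\<^sub>R z) \<le> 0"
        using x jz by (intro insert.prems)
          (auto simp: blinfun.diff_right blinfun.scaleR_right blinfun.diff_left blinfun.scaleR_left mult.commute)
      then show "(g - g z *\<^sub>R a j) x \<le> 0"
        by (simp add: blinfun.diff_right blinfun.scaleR_right blinfun.diff_left blinfun.scaleR_left mult.commute)
    qed
    then obtain c where c: "\<forall>i\<in>I. 0 \<le> c i"
      and geq: "g - g z *\<^sub>R a j = (\<Sum>i\<in>I. c i *\<^sub>R (a i - a i z *\<^sub>R a j))" by blast
    define d where "d = g z - (\<Sum>i\<in>I. c i * a i z)"
    have "(\<Sum>i\<in>I. c i * a i z) \<le> 0"
      using c z by (intro sum_nonpos) (auto simp: mult_le_0_iff)
    then have d: "0 \<le> d" using gz by (simp add: d_def)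
    have "g = (\<Sum>i\<in>I. c i *\<^sub>R a i) + d *\<^sub>R a j"
      using geq by (simp add: d_def scaleR_diff_right sum_subtractf scaleR_left_diff_distrib
          scaleR_sum_left algebra_simps)
    also have "\<dots> = (\<Sum>i\<in>insert j I. (c(j := d)) i *\<^sub>R a i)"
    proof -
      have "(\<Sum>i\<in>I. (c(j := d)) i *\<^sub>R a i) = (\<Sum>i\<in>I. c i *\<^sub>R a i)"
        using insert.hyps by (intro sum.cong) auto
      then show ?thesis using insert.hyps by (simp add: add.commute)
    qed
    finally show ?thesis using c d by (intro exI[of _ "c(j := d)"]) auto
  qed
qed

lemma mem_span_if_kernel:
  fixes F :: "('a::real_normed_vector \<Rightarrow>\<^sub>L real) set" and g :: "'a \<Rightarrow>\<^sub>L real"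
  assumes "finite F" "\<And>x. (\<And>f. f \<in> F \<Longrightarrow> f x = 0) \<Longrightarrow> g x = 0"
  shows "g \<in> span F"
proof -
  have "\<exists>c. (\<forall>i\<in>F \<union> uminus ` F. 0 \<le> c i) \<and> g = (\<Sum>i\<in>F \<union> uminus ` F. c i *\<^sub>R i)"
  proof (rule Farkas)
    fix x assume x: "\<And>i. i \<in> F \<union> uminus ` F \<Longrightarrow> i x \<le> 0"
    have "f x = 0" if "f \<in> F" for f
      using x[of f] x[of "- f"] that by (simp add: blinfun.minus_left)
    then show "g x \<le> 0" using assms(2) by simp
  qed (use assms in auto)
  then obtain c where "g = (\<Sum>i\<in>F \<union> uminus ` F. c i *\<^sub>R i)" by blast
  also have "\<dots> \<in> span F"
    by (intro span_sum span_scale) (auto intro: span_base span_neg)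
  finally show ?thesis .
qed

text \<open>This plays the role of a basis dual to \<open>F\<close>, also when \<open>F\<close> is linearly
  dependent: a new functional needs a new vector only if it does not vanish on the common kernel of the earlier
  ones.\<close>
lemma finite_separating_family:
  fixes F :: "('a::real_normed_vector \<Rightarrow>\<^sub>L real) set"
  assumes "finite F"
  shows "\<exists>E. finite E \<and> (\<forall>u. \<exists>e\<in>span E. \<forall>f\<in>F. f e = f u)"
  using assms
proof (induction F)
  case empty
  then show ?case by (intro exI[of _ "{}"]) auto
next
  case (insert g F)
  then obtain E where E: "finite E" "\<And>u. \<exists>e\<in>span E. \<forall>f\<in>F. f e = f u" by blast
  show ?case
  proof (cases "\<exists>w. (\<forall>f\<in>F. f w = 0) \<and> g w \<noteq> 0")
    case True
    then obtain w where w: "\<forall>f\<in>F. f w = 0" "g w \<noteq> 0" by blast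
    have "\<exists>e\<in>span (insert w E). \<forall>f\<in>insert g F. f e = f u" for u
    proof -
      obtain e where e: "e \<in> span E" "\<forall>f\<in>F. f e = f u" using E by blast
      let ?e = "e + ((g u - g e) / g w) *\<^sub>R w"
      have "e \<in> span (insert w E)" using e(1) span_mono[of E "insert w E"] by blast
      then have "?e \<in> span (insert w E)"
        by (intro span_add span_scale) (auto intro: span_base)
      moreover have "\<forall>f\<in>insert g F. f ?e = f u"
        using w e by (auto simp: blinfun.add_right blinfun.scaleR_right)
      ultimately show ?thesis by blast
    qed
    then show ?thesis using E(1) by (intro exI[of _ "insert w E"]) auto
  next
    case False
    have "\<exists>e\<in>span E. \<forall>f\<in>insert g F. f e = f u" for u
    proof -
      obtain e where e: "e \<in> span E" "\<forall>f\<in>F. f e = f u" using E by blast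
      then have "\<forall>f\<in>F. f (e - u) = 0" by (simp add: blinfun.diff_right)
      then have "g (e - u) = 0" using False by blast
      with e show ?thesis by (auto simp: blinfun.diff_right)
    qed
    then show ?thesis using E(1) by blast
  qed
qed

section \<open>Finite systems of inequalities and polytopes\<close>

text \<open>With \<open>p\<close> the values of the constraints at a point and \<open>s\<close> their slopes along
  a ray, \<open>t\<close> is the time at which the ray leaves the polyhedron, and \<open>i\<close> is a constraint
  that becomes tight at this moment.\<close>
lemma exit_time:
  fixes p s :: "'i \<Rightarrow> real"
  assumes fin: "finite G" and j: "j \<in> G" "0 < s j" and tight: "\<And>i. i \<in> G \<Longrightarrow> p i = 1 \<Longrightarrow> s i = 0"
    and p: "\<And>i. i \<in> G \<Longrightarrow> p i \<le> 1"
  obtains t i where "0 < t" "i \<in> G" "p i < 1" "p i + t * s i = 1" "\<And>k. k \<in> G \<Longrightarrow> p k + t * s k \<le> 1"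
proof -
  let ?P = "{k \<in> G. 0 < s k}"
  define T where "T = (\<lambda>k. (1 - p k) / s k) ` ?P"
  have T: "finite T" "T \<noteq> {}" unfolding T_def using fin j by auto
  define t where "t = Min T"
  obtain i where i: "i \<in> ?P" "t = (1 - p i) / s i"
    using Min_in[OF T] unfolding t_def T_def by blast
  have pi: "p i < 1" using tight[of i] p[of i] i by force
  have t: "0 < t" using pi i by simp
  have "p k + t * s k \<le> 1" if k: "k \<in> G" for k
  proof (cases "0 < s k")
    case True
    have "t \<le> (1 - p k) / s k" unfolding t_def using T k True by (intro Min_le) (auto simp: T_def)
    with True show ?thesis by (simp add: field_simps)
  next
    case False
    then have "t * s k \<le> 0" using t by (simp add: mult_le_0_iff)
    then show ?thesis using p[OF k] by linarith
  qed
  moreover have "p i + t * s i = 1" using i by simp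
  ultimately show thesis using that[OF t _ pi] i by blast
qed

lemma mem_convex_hull_between:
  fixes y d :: "'a::real_vector"
  assumes "y + s *\<^sub>R d \<in> convex hull V" "y - t *\<^sub>R d \<in> convex hull V" "0 < s" "0 < t"
  shows "y \<in> convex hull V"
proof -
  have "(t / (s + t)) *\<^sub>R (y + s *\<^sub>R d) + (s / (s + t)) *\<^sub>R (y - t *\<^sub>R d) \<in> convex hull V"
    using assms by (intro convexD[OF convex_convex_hull]) (auto simp: add_divide_distrib[symmetric] add.commute)
  also have "(t / (s + t)) *\<^sub>R (y + s *\<^sub>R d) + (s / (s + t)) *\<^sub>R (y - t *\<^sub>R d)
      = (t / (s + t) + s / (s + t)) *\<^sub>R y"
    by (simp add: algebra_simps)
  also have "t / (s + t) + s / (s + t) = 1"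
    using assms by (simp add: add_divide_distrib[symmetric] add.commute)
  finally show ?thesis by simp
qed

text \<open>A point of the polyhedron that is not determined by its tight constraints lies on a line along which
  all of them stay tight. Following this line in both directions, one meets further constraints, as the polyhedron
  contains no ray; so induction on the number of slack constraints writes the point as a convex combination of
  points determined by their tight constraints. There are at most as many of these as sets of constraints. The
  argument is also applied with functionals as the points and evaluations as the constraints.\<close>
theorem polytope_finite_inequalities:
  fixes \<phi> :: "'i \<Rightarrow> 'a::real_vector \<Rightarrow> real"
  assumes fin: "finite G" and lin: "\<And>i. i \<in> G \<Longrightarrow> linear (\<phi> i)" and Y: "subspace Y"
    and noray: "\<And>d. d \<in> Y \<Longrightarrow> d \<noteq> 0 \<Longrightarrow> \<exists>i\<in>G. 0 < \<phi> i d"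
  shows "polytope {y \<in> Y. \<forall>i\<in>G. \<phi> i y \<le> 1}"
proof -
  define P where "P = {y \<in> Y. \<forall>i\<in>G. \<phi> i y \<le> 1}"
  define A where "A y = {i \<in> G. \<phi> i y = 1}" for y
  \<comment> \<open>The vertices: the points determined by their tight constraints.\<close>
  define V where "V = {y \<in> P. \<forall>d\<in>Y. (\<forall>i\<in>A y. \<phi> i d = 0) \<longrightarrow> d = 0}"
  \<comment> \<open>Hence a vertex can be recovered from its set of tight constraints.\<close>
  have "inj_on A V"
  proof (rule inj_onI)
    fix y z assume yz: "y \<in> V" "z \<in> V" "A y = A z"
    have "\<forall>i\<in>A y. \<phi> i (y - z) = 0"
      using yz lin by (auto simp: A_def linear_diff)
    moreover have "y - z \<in> Y" using yz Y by (auto simp: V_def P_def intro: subspace_diff)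
    ultimately show "y = z" using yz(1) by (auto simp: V_def)
  qed
  moreover have "finite (A ` V)"
    using fin by (rule finite_surj[of "Pow G" _ id, OF finite_Pow_iff[THEN iffD2]]) (auto simp: A_def)
  ultimately have finV: "finite V" by (rule inj_on_finite[OF _ subset_refl])
  have "convex P"
  proof (rule convexI)
    fix x y and u v :: real assume xy: "x \<in> P" "y \<in> P" and uv: "0 \<le> u" "0 \<le> v" "u + v = 1"
    have "\<phi> i (u *\<^sub>R x + v *\<^sub>R y) \<le> 1" if i: "i \<in> G" for i
    proof -
      have "\<phi> i (u *\<^sub>R x + v *\<^sub>R y) = u * \<phi> i x + v * \<phi> i y"
        using lin[OF i] by (simp add: linear_add linear_scale)
      also have "\<dots> \<le> u * 1 + v * 1"
        using xy uv i by (intro add_mono mult_left_mono) (auto simp: P_def)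
      finally show ?thesis using uv by simp
    qed
    then show "u *\<^sub>R x + v *\<^sub>R y \<in> P"
      using xy Y by (auto simp: P_def intro: subspace_add subspace_scale)
  qed
  then have hull_sub: "convex hull V \<subseteq> P" by (intro hull_minimal) (auto simp: V_def)
  have "y \<in> convex hull V" if "y \<in> P" for y
    using that
  proof (induction "card (G - A y)" arbitrary: y rule: less_induct)
    case less
    show ?case
    proof (cases "y \<in> V")
      case True
      then show ?thesis by (rule hull_inc)
    next
      case False
      then obtain d where d: "d \<in> Y" "d \<noteq> 0" "\<And>i. i \<in> A y \<Longrightarrow> \<phi> i d = 0"
        using less.prems by (auto simp: V_def)
      have step: "\<exists>t>0. y + t *\<^sub>R e \<in> convex hull V"
        if e: "e \<in> Y" "e \<noteq> 0" "\<And>i. i \<in> A y \<Longrightarrow> \<phi> i e = 0" for e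
      proof -
        obtain j where j: "j \<in> G" "0 < \<phi> j e" using noray e by blast
        obtain t i where t: "0 < t" "i \<in> G" "\<phi> i y < 1" "\<phi> i y + t * \<phi> i e = 1"
          "\<And>k. k \<in> G \<Longrightarrow> \<phi> k y + t * \<phi> k e \<le> 1"
        proof (rule exit_time[of G j "\<lambda>i. \<phi> i e" "\<lambda>i. \<phi> i y"])
          show "\<phi> i e = 0" if "i \<in> G" "\<phi> i y = 1" for i using that e by (auto simp: A_def)
          show "\<phi> i y \<le> 1" if "i \<in> G" for i using that less.prems by (auto simp: P_def)
          show "finite G" "j \<in> G" "0 < \<phi> j e" by fact+
        qed (rule that)
        have val: "\<phi> k (y + t *\<^sub>R e) = \<phi> k y + t * \<phi> k e" if "k \<in> G" for k
          using lin[OF that] by (simp add: linear_add linear_scale)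
        have "y + t *\<^sub>R e \<in> P"
          using t val e less.prems Y by (auto simp: P_def intro: subspace_add subspace_scale)
        moreover have "G - A (y + t *\<^sub>R e) \<subset> G - A y"
        proof -
          have "A y \<subseteq> A (y + t *\<^sub>R e)" using e val by (auto simp: A_def)
          moreover have "i \<in> A (y + t *\<^sub>R e)" "i \<in> G - A y" using t val by (auto simp: A_def)
          ultimately show ?thesis by blast
        qed
        then have "card (G - A (y + t *\<^sub>R e)) < card (G - A y)"
          using fin by (intro psubset_card_mono) auto
        ultimately show ?thesis using less.hyps t by blast
      qed
      obtain s where s: "0 < s" "y + s *\<^sub>R d \<in> convex hull V" using step[of d] d by blast
      obtain t where t: "0 < t" "y + t *\<^sub>R (- d) \<in> convex hull V"
      proof -
        have "- d \<in> Y" "- d \<noteq> 0" "\<And>i. i \<in> A y \<Longrightarrow> \<phi> i (- d) = 0"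
          using d Y lin by (auto simp: subspace_neg linear_neg A_def)
        then show ?thesis using step[of "- d"] that by blast
      qed
      show ?thesis
        using s t by (intro mem_convex_hull_between[of y s d V t]) auto
    qed
  qed
  then have "P = convex hull V" using hull_sub by blast
  then show ?thesis using finV by (auto simp: polytope_def P_def)
qed

text \<open>Adding a vector \<open>b\<close> outside the closed subspace \<open>span B\<close>: the positive
  distance of \<open>b\<close> to it bounds the coefficient of \<open>b\<close>, and then also the component in
  \<open>span B\<close>, of every vector of bounded norm.\<close>
lemma compact_cball_Int_span:
  fixes B :: "'a::real_normed_vector set"
  assumes "finite B"
  shows "compact (cball 0 r \<inter> span B)"
  using assms
proof (induction B arbitrary: r rule: finite_induct)
  case empty
  have "cball 0 r \<inter> span {} = (if 0 \<le> r then {0::'a} else {})" by auto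
  then show ?case by simp
next
  case (insert b B)
  show ?case
  proof (cases "b \<in> span B")
    case True
    then show ?thesis using insert.IH by (simp add: span_redundant)
  next
    case False
    have closed: "closed (span B)"
      unfolding closed_sequential_limits
    proof (intro allI impI, elim conjE)
      fix x :: "nat \<Rightarrow> 'a" and l assume x: "\<forall>n. x n \<in> span B" "x \<longlonglongrightarrow> l"
      obtain r where r: "\<forall>n. norm (x n) \<le> r"
        using convergent_imp_Bseq[OF convergentI[OF x(2)]] by (auto simp: Bseq_def)
      have "closed (cball 0 r \<inter> span B)" using insert.IH compact_imp_closed by blast
      then have "l \<in> cball 0 r \<inter> span B"
        by (rule closed_sequentially[OF _ _ x(2)]) (use x r in auto)
      then show "l \<in> span B" by simp
    qed
    define \<delta> where "\<delta> = infdist b (span B)"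
    have ne: "span B \<noteq> {}" using span_zero by blast
    have \<delta>: "0 < \<delta>"
      using infdist_pos_not_in_closed[OF closed ne False] by (simp add: \<delta>_def)
    define C where "C = (\<lambda>(y, t). y + t *\<^sub>R b) `
      ((cball 0 (r + r / \<delta> * norm b) \<inter> span B) \<times> {- r / \<delta>..r / \<delta>})"
    have "compact C"
      unfolding C_def using insert.IH
      by (intro compact_continuous_image compact_Times) (auto simp: case_prod_beta intro!: continuous_intros)
    moreover have "cball 0 r \<inter> span (insert b B) = cball 0 r \<inter> C"
    proof (intro equalityI subsetI)
      fix x assume x: "x \<in> cball 0 r \<inter> span (insert b B)"
      then obtain t where t: "x - t *\<^sub>R b \<in> span B" by (auto simp: span_insert)
      have nx: "norm x \<le> r" using x by simp
      have "\<bar>t\<bar> * \<delta> \<le> norm x"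
      proof (cases "t = 0")
        case False
        have "(- 1 / t) *\<^sub>R (x - t *\<^sub>R b) \<in> span B" using t by (rule span_scale)
        then have "\<delta> \<le> dist b ((- 1 / t) *\<^sub>R (x - t *\<^sub>R b))"
          unfolding \<delta>_def by (rule infdist_le)
        also have "\<dots> = norm x / \<bar>t\<bar>"
          using False by (simp add: dist_norm scaleR_diff_right divide_inverse)
        finally show ?thesis using False by (simp add: field_simps)
      qed simp
      with nx have "\<bar>t\<bar> \<le> r / \<delta>" using \<delta> by (simp add: field_simps)
      moreover have "norm (x - t *\<^sub>R b) \<le> r + r / \<delta> * norm b"
      proof -
        have "norm (x - t *\<^sub>R b) \<le> norm x + \<bar>t\<bar> * norm b"
          using norm_triangle_ineq4[of x "t *\<^sub>R b"] by simp
        also have "\<dots> \<le> r + r / \<delta> * norm b"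
          using nx \<open>\<bar>t\<bar> \<le> r / \<delta>\<close> by (intro add_mono mult_right_mono) auto
        finally show ?thesis .
      qed
      ultimately have "x \<in> C"
        unfolding C_def using t by (intro image_eqI[of _ _ "(x - t *\<^sub>R b, t)"]) auto
      then show "x \<in> cball 0 r \<inter> C" using x by simp
    next
      fix x assume x: "x \<in> cball 0 r \<inter> C"
      then obtain y t where "y \<in> span B" "x = y + t *\<^sub>R b" by (auto simp: C_def)
      then have "x \<in> span (insert b B)"
        using span_mono[of B "insert b B"] by (intro_classes | auto intro!: span_add span_scale intro: span_base)
      then show "x \<in> cball 0 r \<inter> span (insert b B)" using x by simp
    qed
    ultimately show ?thesis by (simp add: closed_Int_compact)
  qed
qed

section \<open>Minkowski functionals\<close>

definition minkowski_functional :: "'a::real_vector set \<Rightarrow> 'a \<Rightarrow> real" where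
  "minkowski_functional B x = Inf {t. 0 < t \<and> x /\<^sub>R t \<in> B}"

lemma minkowski_le: "0 < t \<Longrightarrow> x /\<^sub>R t \<in> B \<Longrightarrow> minkowski_functional B x \<le> t"
  unfolding minkowski_functional_def by (rule cInf_lower) (auto intro!: bdd_belowI[of _ 0])

lemma zero_interior_absorbs:
  fixes x :: "'a::real_normed_vector"
  assumes "ball 0 r \<subseteq> B" "0 < t" "norm x < t * r"
  shows "x /\<^sub>R t \<in> B"
  using assms by (auto simp: field_simps subset_iff)

lemma minkowski_norm_le:
  fixes x :: "'a::real_normed_vector"
  assumes "ball 0 r \<subseteq> B" "0 < r"
  shows "minkowski_functional B x \<le> norm x / r"
proof (rule field_le_epsilon)
  fix e :: real assume "0 < e"
  moreover have "0 \<le> norm x / r" using assms by simp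
  ultimately have "0 < norm x / r + e" by linarith
  with \<open>0 < e\<close> show "minkowski_functional B x \<le> norm x / r + e"
    using assms by (intro minkowski_le zero_interior_absorbs[OF assms(1)]) (auto simp: field_simps)
qed

lemma minkowski_lessD:
  fixes x :: "'a::real_normed_vector"
  assumes "convex B" "ball 0 r \<subseteq> B" "0 < r" "minkowski_functional B x < s"
  shows "0 < s \<and> x /\<^sub>R s \<in> B"
proof -
  have "norm x < ((norm x + 1) / r) * r" "0 < (norm x + 1) / r"
    using assms(3) by (auto intro!: divide_pos_pos add_nonneg_pos)
  then have "{t. 0 < t \<and> x /\<^sub>R t \<in> B} \<noteq> {}"
    using zero_interior_absorbs[OF assms(2), of "(norm x + 1) / r" x] by blast
  then obtain t where t: "0 < t" "x /\<^sub>R t \<in> B" "t < s"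
    using cInf_lessD[of "{t. 0 < t \<and> x /\<^sub>R t \<in> B}" s] assms(4) unfolding minkowski_functional_def by blast
  have "0 \<in> B" using assms by auto
  then have "(t / s) *\<^sub>R (x /\<^sub>R t) + (1 - t / s) *\<^sub>R 0 \<in> B"
    using t assms(1) by (intro convexD) (auto simp: field_simps)
  then show ?thesis using t by (simp add: field_simps)
qed

lemma sublinear_minkowski:
  fixes B :: "'a::real_normed_vector set"
  assumes B: "convex B" "ball 0 r \<subseteq> B" "0 < r"
  shows "sublinear (minkowski_functional B)"
  unfolding sublinear_def
proof (intro conjI allI impI)
  fix x y :: 'a
  show "minkowski_functional B (x + y) \<le> minkowski_functional B x + minkowski_functional B y"
  proof (rule field_le_epsilon)
    fix e :: real assume e: "0 < e"
    define s where "s = minkowski_functional B x + e / 2"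
    define t where "t = minkowski_functional B y + e / 2"
    have s: "0 < s" "x /\<^sub>R s \<in> B" using minkowski_lessD[OF B, of x s] e by (auto simp: s_def)
    have t: "0 < t" "y /\<^sub>R t \<in> B" using minkowski_lessD[OF B, of y t] e by (auto simp: t_def)
    have "(s / (s + t)) *\<^sub>R (x /\<^sub>R s) + (t / (s + t)) *\<^sub>R (y /\<^sub>R t) \<in> B"
      using s t B(1) by (intro convexD) (auto simp: add_divide_distrib[symmetric])
    also have "(s / (s + t)) *\<^sub>R (x /\<^sub>R s) + (t / (s + t)) *\<^sub>R (y /\<^sub>R t) = (x + y) /\<^sub>R (s + t)"
      using s t by (simp add: scaleR_add_right inverse_eq_divide)
    finally have "minkowski_functional B (x + y) \<le> s + t"
      using s t by (intro minkowski_le) auto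
    then show "minkowski_functional B (x + y) \<le> minkowski_functional B x + minkowski_functional B y + e"
      by (simp add: s_def t_def)
  qed
next
  have le: "minkowski_functional B (c *\<^sub>R x) \<le> c * minkowski_functional B x" if c: "0 < c" for c and x :: 'a
  proof (rule dense_ge)
    fix s assume "c * minkowski_functional B x < s"
    then have "minkowski_functional B x < s / c" using c by (simp add: field_simps)
    then have "0 < s / c \<and> x /\<^sub>R (s / c) \<in> B" by (rule minkowski_lessD[OF B])
    then show "minkowski_functional B (c *\<^sub>R x) \<le> s"
      using c by (intro minkowski_le) (auto simp: field_simps zero_less_divide_iff)
  qed
  fix c :: real and x :: 'a assume "0 \<le> c"
  show "minkowski_functional B (c *\<^sub>R x) = c * minkowski_functional B x"
  proof (cases "c = 0")
    case True
    have "minkowski_functional B 0 \<le> 0" using minkowski_norm_le[OF B(2,3), of 0] by simp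
    moreover have "0 \<le> minkowski_functional B 0"
      using minkowski_lessD[OF B, of 0 0] by force
    ultimately show ?thesis using True by simp
  next
    case False
    with \<open>0 \<le> c\<close> have c: "0 < c" by simp
    have "minkowski_functional B ((1/c) *\<^sub>R (c *\<^sub>R x)) \<le> (1/c) * minkowski_functional B (c *\<^sub>R x)"
      using c by (intro le) auto
    with le[OF c, of x] c show ?thesis by (simp add: field_simps)
  qed
qed

lemma minkowski_le_one_iff:
  fixes x :: "'a::real_normed_vector"
  assumes B: "convex B" "ball 0 r \<subseteq> B" "0 < r" and "closed B"
  shows "minkowski_functional B x \<le> 1 \<longleftrightarrow> x \<in> B"
proof
  assume le: "minkowski_functional B x \<le> 1"
  have "(\<lambda>n. x /\<^sub>R (1 + 1 / real (Suc n))) \<longlonglongrightarrow> x /\<^sub>R (1 + 0)"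
    by (intro tendsto_intros lim_1_over_n[THEN LIMSEQ_Suc]) auto
  then have lim: "(\<lambda>n. x /\<^sub>R (1 + 1 / real (Suc n))) \<longlonglongrightarrow> x" by simp
  have "x /\<^sub>R (1 + 1 / real (Suc n)) \<in> B" for n
  proof -
    have "minkowski_functional B x < 1 + 1 / real (Suc n)"
      using le by (rule order_le_less_trans) simp
    then show ?thesis using minkowski_lessD[OF B] by blast
  qed
  then show "x \<in> B" using closed_sequentially[OF \<open>closed B\<close> _ lim] by blast
qed (use minkowski_le[of 1 x B] in simp)

lemma equivalent_norm_minkowski:
  fixes B :: "'a::real_normed_vector set"
  assumes B: "convex B" "ball 0 r \<subseteq> B" "0 < r" and bounded: "bounded B" and sym: "\<And>x. x \<in> B \<Longrightarrow> - x \<in> B"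
  shows "equivalent_norm (minkowski_functional B)"
proof -
  note sub = sublinear_minkowski[OF B]
  obtain R where R: "0 < R" "\<And>x. x \<in> B \<Longrightarrow> norm x \<le> R" using bounded bounded_pos by blast
  have low: "norm x / R \<le> minkowski_functional B x" for x
  proof (rule dense_ge)
    fix s assume "minkowski_functional B x < s"
    then have "0 < s" "x /\<^sub>R s \<in> B" using minkowski_lessD[OF B] by auto
    then show "norm x / R \<le> s" using R(2)[of "x /\<^sub>R s"] R(1) by (simp add: field_simps)
  qed
  have neg: "minkowski_functional B (- x) = minkowski_functional B x" for x
  proof -
    have "- x /\<^sub>R t \<in> B \<longleftrightarrow> x /\<^sub>R t \<in> B" for t
      using sym[of "x /\<^sub>R t"] sym[of "- x /\<^sub>R t"] by auto
    then show ?thesis by (simp add: minkowski_functional_def)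
  qed
  show ?thesis
    unfolding equivalent_norm_def
  proof (intro conjI allI)
    show "minkowski_functional B x = 0 \<longleftrightarrow> x = 0" for x
      using low[of x] R(1) sublinear_zero[OF sub] by (auto simp: field_simps)
    show "minkowski_functional B (c *\<^sub>R x) = \<bar>c\<bar> * minkowski_functional B x" for c x
      using sublinear_scale[OF sub, of c x] sublinear_scale[OF sub, of "- c" "- x"] neg[of x]
      by (cases "0 \<le> c") auto
    show "minkowski_functional B (x + y) \<le> minkowski_functional B x + minkowski_functional B y" for x y
      by (rule sublinear_add[OF sub])
    show "\<exists>a>0. \<exists>b>0. \<forall>x. a * norm x \<le> minkowski_functional B x \<and> minkowski_functional B x \<le> b * norm x"
      using low minkowski_norm_le[OF B(2,3)] R(1) B(3)
      by (intro exI[of _ "1 / R"] exI[of _ "1 / r"] conjI) auto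
  qed
qed

section \<open>Separation of convex bodies\<close>

lemma small_step_in_open:
  fixes x z :: "'a::real_normed_vector"
  assumes "open V" "x \<in> V"
  obtains t where "0 < t" "t < 1" "x + t *\<^sub>R z \<in> V" "x - t *\<^sub>R z \<in> V"
proof -
  obtain e where e: "0 < e" "ball x e \<subseteq> V" using assms by (meson openE)
  define t where "t = e / (norm z + 1 + e)"
  have p: "0 < norm z + 1 + e" using e by (simp add: add_nonneg_pos)
  then have t: "0 < t" using e by (simp add: t_def)
  have "t < 1" using p e by (simp add: t_def add_nonneg_pos)
  have "t * (norm z + 1 + e) = e" using p by (simp add: t_def)
  then have "t * norm z + t + t * e = e" by (simp add: algebra_simps)
  moreover have "0 < t * e" using t e by simp
  ultimately have "t * norm z < e" using t by linarith
  then have "x + t *\<^sub>R z \<in> ball x e" "x - t *\<^sub>R z \<in> ball x e" using t by (auto simp: dist_norm)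
  then show thesis using that[OF \<open>0 < t\<close> \<open>t < 1\<close>] e by blast
qed

lemma bounded_linear_if_le_norm:
  fixes f :: "'a::real_normed_vector \<Rightarrow> real"
  assumes "linear f" "\<And>x. f x \<le> C * norm x"
  shows "bounded_linear f"
proof -
  have "norm (f x) \<le> norm x * C" for x
    using assms(2)[of x] assms(2)[of "- x"] linear_neg[OF assms(1), of x]
    by (auto simp: abs_le_iff mult.commute)
  then show ?thesis
    using assms(1) by (auto simp: bounded_linear_def bounded_linear_axioms_def)
qed

text \<open>Every point of a segment from a point of \<open>L\<close> to an interior point is itself interior,
  except possibly the first one.\<close>
lemma convex_body_subset_closure_interior:
  fixes L :: "'a::real_normed_vector set"
  assumes "convex L" "interior L \<noteq> {}"
  shows "L \<subseteq> closure (interior L)"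
proof
  fix x assume x: "x \<in> L"
  obtain c e where c: "0 < e" "ball c e \<subseteq> L" using assms(2) by (meson all_not_in_conv mem_interior)
  have int: "x + s *\<^sub>R (c - x) \<in> interior L" if s: "0 < s" "s \<le> 1" for s
  proof -
    have "ball (x + s *\<^sub>R (c - x)) (s * e) \<subseteq> L"
    proof
      fix y assume y: "y \<in> ball (x + s *\<^sub>R (c - x)) (s * e)"
      define z where "z = (y - (1 - s) *\<^sub>R x) /\<^sub>R s"
      have "z - c = (y - (x + s *\<^sub>R (c - x))) /\<^sub>R s"
        using s by (simp add: z_def algebra_simps)
      then have "norm (z - c) = norm (y - (x + s *\<^sub>R (c - x))) / s"
        using s by (simp only: norm_scaleR) (simp add: divide_inverse)
      also have "\<dots> < e"
        using y s by (simp only: mem_ball dist_norm norm_minus_commute) (simp add: pos_divide_less_eq mult.commute)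
      finally have "norm (z - c) < e" .
      then have "z \<in> L" using c by (auto simp: dist_norm norm_minus_commute)
      then have "(1 - s) *\<^sub>R x + s *\<^sub>R z \<in> L"
        using x s assms(1) by (intro convexD) auto
      moreover have "(1 - s) *\<^sub>R x + s *\<^sub>R z = y" using s by (simp add: z_def)
      ultimately show "y \<in> L" by simp
    qed
    then show ?thesis using s c by (intro interiorI[OF open_ball]) auto
  qed
  have "(\<lambda>n. x + (1 / real (Suc n)) *\<^sub>R (c - x)) \<longlonglongrightarrow> x + 0 *\<^sub>R (c - x)"
    by (intro tendsto_intros lim_1_over_n[THEN LIMSEQ_Suc])
  then have "(\<lambda>n. x + (1 / real (Suc n)) *\<^sub>R (c - x)) \<longlonglongrightarrow> x" by simp
  then show "x \<in> closure (interior L)"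
    unfolding closure_sequential using int by (intro exI conjI allI) (auto simp: field_simps)
qed

text \<open>The set \<open>K - interior L\<close>, translated so as to be a neighbourhood of the origin, misses the
  translation vector \<open>w\<close>. A linear functional below its Minkowski functional, with the same value at
  \<open>w\<close>, separates. Since \<open>c\<close> is interior to \<open>K\<close>, the separating functional
  can be normalized relative to \<open>c\<close>.\<close>
theorem separating_functional:
  fixes K L :: "'a::real_normed_vector set"
  assumes K: "convex K" "c \<in> interior K" and L: "convex L" "interior L \<noteq> {}"
    and disj: "interior K \<inter> interior L = {}"
  obtains g :: "'a \<Rightarrow>\<^sub>L real" where "\<And>k. k \<in> K \<Longrightarrow> g (k - c) \<le> 1" "\<And>l. l \<in> L \<Longrightarrow> 1 \<le> g (l - c)"
proof -
  have KL: "K \<inter> interior L = {}"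
  proof -
    have "closure (interior K) \<inter> interior L = {}"
      using disj by (simp add: open_Int_closure_eq_empty Int_commute)
    then show ?thesis using convex_body_subset_closure_interior[OF K(1)] K(2) by blast
  qed
  obtain l0 where l0: "l0 \<in> interior L" using L by blast
  define w where "w = l0 - c"
  define A where "A = {k - l + w | k l. k \<in> K \<and> l \<in> interior L}"
  have "convex A"
  proof (rule convexI)
    fix x y and u v :: real assume xy: "x \<in> A" "y \<in> A" and uv: "0 \<le> u" "0 \<le> v" "u + v = 1"
    obtain k l k' l' where kl: "k \<in> K" "l \<in> interior L" "x = k - l + w"
      "k' \<in> K" "l' \<in> interior L" "y = k' - l' + w"
      using xy unfolding A_def by blast
    have "u *\<^sub>R x + v *\<^sub>R y = (u *\<^sub>R k + v *\<^sub>R k') - (u *\<^sub>R l + v *\<^sub>R l') + (u + v) *\<^sub>R w"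
      unfolding kl by (simp add: algebra_simps)
    also have "\<dots> \<in> A"
      unfolding uv(3) A_def using kl uv K(1) convex_interior[OF L(1)]
      by (auto intro!: exI convexD)
    finally show "u *\<^sub>R x + v *\<^sub>R y \<in> A" .
  qed
  moreover obtain r where r: "0 < r" "ball 0 r \<subseteq> A"
  proof -
    obtain r where r: "0 < r" "ball c r \<subseteq> K" using K(2) by (auto simp: mem_interior)
    have "ball 0 r \<subseteq> A"
    proof
      fix x :: 'a assume "x \<in> ball 0 r"
      then have "c + x \<in> K" using r by (auto simp: dist_norm)
      moreover have "x = (c + x) - l0 + w" by (simp add: w_def)
      ultimately show "x \<in> A" unfolding A_def using l0 by blast
    qed
    with r show ?thesis using that by blast
  qed
  ultimately have A: "convex A" "ball 0 r \<subseteq> A" "0 < r" by auto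
  have "w \<notin> A" using KL by (auto simp: A_def)
  then have pw: "1 \<le> minkowski_functional A w" using minkowski_lessD[OF A, of w 1] by force
  obtain f where f: "linear f" "f \<le> minkowski_functional A" "f w = minkowski_functional A w"
    using Hahn_Banach_extreme[OF sublinear_minkowski[OF A]] by metis
  have "f x \<le> (1 / r) * norm x" for x
    using f(2) minkowski_norm_le[OF A(2,3), of x] by (auto simp: le_fun_def intro: order_trans)
  then have blf: "bounded_linear f" by (rule bounded_linear_if_le_norm[OF f(1)])
  have sep: "f k \<le> f l" if "k \<in> K" "l \<in> interior L" for k l
  proof -
    have "k - l + w \<in> A" using that by (auto simp: A_def)
    then have "minkowski_functional A (k - l + w) \<le> 1" by (intro minkowski_le) auto
    then have "f (k - l + w) \<le> f w" using f(2,3) pw by (metis le_funD order_trans)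
    then show ?thesis using f(1) by (simp add: linear_add linear_diff)
  qed
  define a where "a = (SUP k\<in>K. f (k - c))"
  have cK: "c \<in> K" using K(2) interior_subset by blast
  have bdd: "bdd_above ((\<lambda>k. f (k - c)) ` K)"
    using sep[OF _ l0] f(1) by (intro bdd_aboveI2[of _ _ "f l0 - f c"]) (auto simp: linear_diff)
  have Ka: "f (k - c) \<le> a" if "k \<in> K" for k
    unfolding a_def using that bdd by (rule cSUP_upper)
  have La: "a \<le> f (l - c)" if "l \<in> interior L" for l
    unfolding a_def using sep that f(1) cK by (intro cSUP_least) (auto simp: linear_diff)
  have a: "0 < a"
  proof -
    obtain r where r: "0 < r" "ball c r \<subseteq> K" using K(2) by (auto simp: mem_interior)
    have w0: "w \<noteq> 0" using pw f linear_0[OF f(1)] by auto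
    define s where "s = r / (2 * norm w)"
    have s: "0 < s" "norm (s *\<^sub>R w) < r" using r w0 by (auto simp: s_def)
    have "c + s *\<^sub>R w \<in> K" using s r by (auto simp: dist_norm)
    then have "s * f w \<le> a" using Ka[of "c + s *\<^sub>R w"] f(1) by (simp add: linear_scale)
    moreover have "0 < s * f w" using s pw f(3) by simp
    ultimately show ?thesis by linarith
  qed
  define g where "g = Blinfun (\<lambda>x. f x / a)"
  have g: "g x = f x / a" for x
    unfolding g_def using blf by (subst bounded_linear_Blinfun_apply) (auto intro: bounded_linear_divide bounded_linear_compose)
  show thesis
  proof (rule that[of g])
    show "g (k - c) \<le> 1" if "k \<in> K" for k using Ka[OF that] a by (simp add: g)
    fix l assume "l \<in> L"
    then have l: "l \<in> closure (interior L)" using convex_body_subset_closure_interior[OF L] by blast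
    have "closed {x. 1 \<le> g (x - c)}"
      by (intro closed_Collect_le continuous_intros)
    moreover have "interior L \<subseteq> {x. 1 \<le> g (x - c)}" using La a by (auto simp: g)
    ultimately show "1 \<le> g (l - c)" using l closure_minimal by blast
  qed
qed

section \<open>Norms that are locally finite maxima of functionals\<close>

definition locally_max :: "('a::real_normed_vector \<Rightarrow> real) \<Rightarrow> bool" where
  "locally_max N \<longleftrightarrow> (\<forall>x. N x = 1 \<longrightarrow> (\<exists>F V. finite (F :: ('a \<Rightarrow>\<^sub>L real) set) \<and> open V \<and> x \<in> V \<and>
     (\<forall>f\<in>F. f x = 1 \<and> (\<forall>y. f y \<le> N y)) \<and> (\<forall>y\<in>V. \<exists>f\<in>F. f y = N y)))"

lemma equivalent_norm_zero_iff: "equivalent_norm N \<Longrightarrow> N x = 0 \<longleftrightarrow> x = 0"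
  and equivalent_norm_scale: "equivalent_norm N \<Longrightarrow> N (c *\<^sub>R x) = \<bar>c\<bar> * N x"
  and equivalent_norm_triangle: "equivalent_norm N \<Longrightarrow> N (x + y) \<le> N x + N y"
  by (auto simp: equivalent_norm_def)

lemma equivalent_norm_bounds:
  assumes "equivalent_norm N"
  obtains a b where "0 < a" "0 < b" "\<And>x. a * norm x \<le> N x" "\<And>x. N x \<le> b * norm x"
  using assms by (auto simp: equivalent_norm_def)

lemma equivalent_norm_minus: "equivalent_norm N \<Longrightarrow> N (- x) = N x"
  using equivalent_norm_scale[of N "-1" x] by simp

lemma equivalent_norm_nonneg: "equivalent_norm N \<Longrightarrow> 0 \<le> N x"
  using equivalent_norm_triangle[of N x "- x"] equivalent_norm_minus[of N x]
    equivalent_norm_zero_iff[of N 0] by simp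

lemma sublinear_equivalent_norm: "equivalent_norm N \<Longrightarrow> sublinear N"
  by (simp add: sublinear_def equivalent_norm_def)

lemma continuous_on_equivalent_norm:
  fixes N :: "'a::real_normed_vector \<Rightarrow> real"
  assumes N: "equivalent_norm N"
  shows "continuous_on A N"
proof -
  obtain b where b: "0 < b" "\<And>x. N x \<le> b * norm x" using equivalent_norm_bounds[OF N] by metis
  have "dist (N y) (N x) \<le> b * dist y x" for x y
  proof -
    have "N x \<le> N y + N (x - y)" "N y \<le> N x + N (y - x)"
      using equivalent_norm_triangle[OF N, of y "x - y"] equivalent_norm_triangle[OF N, of x "y - x"] by auto
    moreover have "N (x - y) \<le> b * dist y x" "N (y - x) \<le> b * dist y x"
      using b(2)[of "x - y"] b(2)[of "y - x"] by (auto simp: dist_norm norm_minus_commute)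
    ultimately show ?thesis by (simp add: dist_real_def)
  qed
  then have "b-lipschitz_on A N" using b(1) by (intro lipschitz_onI) auto
  then show ?thesis by (rule lipschitz_on_continuous_on)
qed

lemma open_normalization_preimage:
  fixes N :: "'a::real_normed_vector \<Rightarrow> real"
  assumes N: "equivalent_norm N" and "open V"
  shows "open {y. y \<noteq> 0 \<and> y /\<^sub>R N y \<in> V}"
proof -
  have "continuous_on (- {0}) (\<lambda>y. y /\<^sub>R N y)"
    using equivalent_norm_zero_iff[OF N] continuous_on_equivalent_norm[OF N]
    by (intro continuous_intros) auto
  then have "open ((\<lambda>y. y /\<^sub>R N y) -` V \<inter> - {0})"
    using assms(2) by (subst (asm) continuous_on_open_vimage) auto
  then show ?thesis by (rule back_subst[of "open"]) auto
qed

text \<open>Only points \<open>y\<close> of the unit sphere need to be tested, because \<open>N\<close> is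
  homogeneous. Functionals with \<open>f x < 1\<close> stay below \<open>N\<close> near \<open>x\<close>, so they
  may be discarded; this is why \<open>f \<le> N\<close> is demanded only of those with
  \<open>f x = 1\<close>.\<close>
lemma locally_maxI:
  fixes N :: "'a::real_normed_vector \<Rightarrow> real"
  assumes N: "equivalent_norm N"
    and loc: "\<And>x. N x = 1 \<Longrightarrow> \<exists>F V. finite (F :: ('a \<Rightarrow>\<^sub>L real) set) \<and> open V \<and> x \<in> V \<and>
      (\<forall>f\<in>F. f x \<le> 1 \<and> (f x = 1 \<longrightarrow> (\<forall>y. f y \<le> N y))) \<and> (\<forall>y\<in>V. N y = 1 \<longrightarrow> (\<exists>f\<in>F. 1 \<le> f y))"
  shows "locally_max N"
  unfolding locally_max_def
proof (intro allI impI)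
  fix x assume x: "N x = 1"
  from loc[OF this] obtain F :: "('a \<Rightarrow>\<^sub>L real) set" and V where F: "finite F"
    "\<And>f. f \<in> F \<Longrightarrow> f x \<le> 1" "\<And>f y. f \<in> F \<Longrightarrow> f x = 1 \<Longrightarrow> f y \<le> N y"
    and V: "open V" "x \<in> V" "\<And>y. y \<in> V \<Longrightarrow> N y = 1 \<Longrightarrow> \<exists>f\<in>F. 1 \<le> f y" by metis
  define G where "G = {f \<in> F. f x = 1}"
  define W where "W = {y. y \<noteq> 0 \<and> y /\<^sub>R N y \<in> V \<inter> (\<Inter>f\<in>F - G. {y. blinfun_apply f y < 1})}"
  have "open W"
    unfolding W_def using V(1) F(1)
    by (intro open_normalization_preimage[OF N] open_Int open_INT ballI open_Collect_less continuous_intros) auto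
  moreover have "x \<in> W"
    using x V(2) F(2) equivalent_norm_zero_iff[OF N, of x] by (force simp: W_def G_def)
  moreover have "\<exists>f\<in>G. f y = N y" if y: "y \<in> W" for y
  proof -
    have Ny: "0 < N y"
      using y equivalent_norm_nonneg[OF N, of y] equivalent_norm_zero_iff[OF N, of y] by (auto simp: W_def)
    then have "N (y /\<^sub>R N y) = 1" by (simp add: equivalent_norm_scale[OF N])
    then obtain f where f: "f \<in> F" "1 \<le> f (y /\<^sub>R N y)" using V(3) y by (auto simp: W_def)
    then have "f \<in> G" using y by (force simp: W_def)
    moreover have "N y \<le> f y" using f Ny by (simp add: blinfun.scaleR_right field_simps)
    moreover have "f y \<le> N y" using \<open>f \<in> G\<close> F(3) by (auto simp: G_def)
    ultimately show ?thesis by (meson antisym)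
  qed
  ultimately show "\<exists>F V. finite (F :: ('a \<Rightarrow>\<^sub>L real) set) \<and> open V \<and> x \<in> V \<and>
     (\<forall>f\<in>F. f x = 1 \<and> (\<forall>y. f y \<le> N y)) \<and> (\<forall>y\<in>V. \<exists>f\<in>F. f y = N y)"
    using F(1,3) by (intro exI[of _ G] exI[of _ W]) (auto simp: G_def)
qed

text \<open>By homogeneity, the description extends from the unit sphere to all points other than the
  origin.\<close>
lemma locally_maxE:
  fixes N :: "'a::real_normed_vector \<Rightarrow> real"
  assumes N: "equivalent_norm N" and "locally_max N" and x: "x \<noteq> 0"
  obtains F :: "('a \<Rightarrow>\<^sub>L real) set" and V where "finite F" "open V" "x \<in> V"
    "\<And>f. f \<in> F \<Longrightarrow> f x = N x" "\<And>f y. f \<in> F \<Longrightarrow> f y \<le> N y" "\<And>y. y \<in> V \<Longrightarrow> \<exists>f\<in>F. f y = N y"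
proof -
  have Nx: "0 < N z" if "z \<noteq> 0" for z
    using that equivalent_norm_nonneg[OF N, of z] equivalent_norm_zero_iff[OF N, of z] by auto
  then have "N (x /\<^sub>R N x) = 1" using x by (force simp: equivalent_norm_scale[OF N])
  then obtain F :: "('a \<Rightarrow>\<^sub>L real) set" and V where F: "finite F" "open V" "x /\<^sub>R N x \<in> V"
    "\<And>f. f \<in> F \<Longrightarrow> f (x /\<^sub>R N x) = 1" "\<And>f y. f \<in> F \<Longrightarrow> f y \<le> N y" "\<And>y. y \<in> V \<Longrightarrow> \<exists>f\<in>F. f y = N y"
    using assms(2) unfolding locally_max_def by metis
  show thesis
  proof (rule that[of F "{y. y \<noteq> 0 \<and> y /\<^sub>R N y \<in> V}"])
    show "open {y. y \<noteq> 0 \<and> y /\<^sub>R N y \<in> V}" using F(2) by (rule open_normalization_preimage[OF N])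
    show "f x = N x" if "f \<in> F" for f
      using F(4)[OF that] Nx[OF x] by (auto simp: blinfun.scaleR_right inverse_eq_divide)
    fix y assume "y \<in> {y. y \<noteq> 0 \<and> y /\<^sub>R N y \<in> V}"
    then have y: "y \<noteq> 0" "y /\<^sub>R N y \<in> V" by auto
    then obtain f where f: "f \<in> F" "f (y /\<^sub>R N y) = N (y /\<^sub>R N y)" using F(6) by blast
    then have "f y = N y"
      using Nx[OF y(1)] by (auto simp: equivalent_norm_scale[OF N] blinfun.scaleR_right inverse_eq_divide)
    then show "\<exists>f\<in>F. f y = N y" using f by blast
  qed (use F x in auto)
qed

section \<open>Support functionals: (VI)-polyhedrality and property \<open>\<Delta>\<close>\<close>

text \<open>For functionals with \<open>f x = 1\<close>, the dual norm disappears: it is one exactly when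
  \<open>f\<close> lies below \<open>N\<close>.\<close>
lemma support_functionals_iff:
  fixes N :: "'a::real_normed_vector \<Rightarrow> real"
  assumes N: "equivalent_norm N" and x: "N x = 1"
  shows "f \<in> support_functionals N x \<longleftrightarrow> f x = 1 \<and> (\<forall>y. f y \<le> N y)"
proof -
  obtain a where a: "0 < a" "\<And>x. a * norm x \<le> N x" using equivalent_norm_bounds[OF N] by metis
  have xb: "x \<in> unit_ball N" using x by (simp add: unit_ball_def)
  have bdd: "bdd_above ((\<lambda>x. \<bar>f x\<bar>) ` unit_ball N)"
  proof (rule bdd_aboveI2)
    fix y assume "y \<in> unit_ball N"
    then have "norm y \<le> 1 / a" using a(2)[of y] a(1) by (simp add: unit_ball_def field_simps)
    then have "norm f * norm y \<le> norm f * (1 / a)" by (intro mult_left_mono) auto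
    then show "\<bar>f y\<bar> \<le> norm f * (1 / a)" using norm_blinfun[of f y] by simp
  qed
  have "dual_norm N f = 1 \<longleftrightarrow> (\<forall>y. f y \<le> N y)" if fx: "f x = 1"
  proof
    assume d: "dual_norm N f = 1"
    show "\<forall>y. f y \<le> N y"
    proof
      fix y
      show "f y \<le> N y"
      proof (cases "y = 0")
        case False
        then have Ny: "0 < N y"
          using equivalent_norm_nonneg[OF N, of y] equivalent_norm_zero_iff[OF N, of y] by auto
        then have "y /\<^sub>R N y \<in> unit_ball N" by (simp add: unit_ball_def equivalent_norm_scale[OF N])
        then have "\<bar>f (y /\<^sub>R N y)\<bar> \<le> dual_norm N f"
          unfolding dual_norm_def by (rule cSUP_upper[OF _ bdd])
        then have "f (y /\<^sub>R N y) \<le> 1" using d by simp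
        then show ?thesis using Ny by (simp add: blinfun.scaleR_right field_simps)
      qed (simp add: equivalent_norm_nonneg[OF N])
    qed
  next
    assume le: "\<forall>y. f y \<le> N y"
    have "dual_norm N f \<le> 1"
      unfolding dual_norm_def
    proof (rule cSUP_least)
      fix y assume y: "y \<in> unit_ball N"
      have "f y \<le> N y" "- f y \<le> N y"
        using le[THEN spec, of y] le[THEN spec, of "- y"]
        by (auto simp: blinfun.minus_right equivalent_norm_minus[OF N])
      then show "\<bar>f y\<bar> \<le> 1" using y by (simp add: unit_ball_def)
    qed (use xb in blast)
    moreover have "\<bar>f x\<bar> \<le> dual_norm N f"
      unfolding dual_norm_def by (rule cSUP_upper[OF xb bdd])
    ultimately show "dual_norm N f = 1" using fx by simp
  qed
  then show ?thesis by (auto simp: support_functionals_def unit_sphere_def)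
qed

lemma norming_functional_extreme:
  fixes N :: "'a::real_normed_vector \<Rightarrow> real"
  assumes N: "equivalent_norm N"
  obtains f :: "'a \<Rightarrow>\<^sub>L real" where "f m = N m" "f extreme_point_of {f. \<forall>y. blinfun_apply f y \<le> N y}"
proof -
  obtain b where b: "\<And>x. N x \<le> b * norm x" using equivalent_norm_bounds[OF N] by metis
  obtain f where f: "linear f" "f \<le> N" "f m = N m"
    "\<And>g h t. linear g \<Longrightarrow> linear h \<Longrightarrow> g \<le> N \<Longrightarrow> h \<le> N \<Longrightarrow> 0 < t \<Longrightarrow> t < 1 \<Longrightarrow>
       f = (\<lambda>x. (1 - t) * g x + t * h x) \<Longrightarrow> g = f \<and> h = f"
    using Hahn_Banach_extreme[OF sublinear_equivalent_norm[OF N]] by blast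
  have "f x \<le> b * norm x" for x using f(2) b[of x] by (auto simp: le_fun_def intro: order_trans)
  then have bl: "bounded_linear f" by (rule bounded_linear_if_le_norm[OF f(1)])
  have F: "blinfun_apply (Blinfun f) = f" using bl by (rule bounded_linear_Blinfun_apply)
  have "Blinfun f extreme_point_of {f. \<forall>y. blinfun_apply f y \<le> N y}"
    unfolding extreme_point_of_def
  proof (intro conjI ballI notI)
    show "Blinfun f \<in> {f. \<forall>y. blinfun_apply f y \<le> N y}" using f(2) F by (simp add: le_fun_def)
    fix g h :: "'a \<Rightarrow>\<^sub>L real"
    assume gh: "g \<in> {f. \<forall>y. blinfun_apply f y \<le> N y}" "h \<in> {f. \<forall>y. blinfun_apply f y \<le> N y}" "Blinfun f \<in> open_segment g h"
    then obtain t where t: "0 < t" "t < 1" "g \<noteq> h" "Blinfun f = (1 - t) *\<^sub>R g + t *\<^sub>R h"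
      by (auto simp: in_segment)
    have "f = (\<lambda>x. (1 - t) * g x + t * h x)"
      using arg_cong[OF t(4), of blinfun_apply]
      by (simp add: F fun_eq_iff blinfun.add_left blinfun.scaleR_left)
    moreover have "linear (blinfun_apply g)" "linear (blinfun_apply h)"
      by (intro bounded_linear.linear blinfun.bounded_linear_right)+
    moreover have "blinfun_apply g \<le> N" "blinfun_apply h \<le> N" using gh by (simp_all add: le_fun_def)
    ultimately have "blinfun_apply g = f \<and> blinfun_apply h = f" using t(1,2) f(4) by blast
    then have "blinfun_apply g = blinfun_apply h" by simp
    then show False using t(3) by (simp add: blinfun_apply_inject)
  qed
  then show thesis using that[of "Blinfun f"] F f(3) by simp
qed

text \<open>The finitely many extreme support functionals at \<open>x\<close> suffice: an extreme point of the dual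
  ball that norms \<open>x + y\<close> is an extreme support functional at \<open>x\<close>, and it takes the value
  one at \<open>y\<close>.\<close>
lemma locally_max_if_VI_Delta:
  fixes N :: "'a::real_normed_vector \<Rightarrow> real"
  assumes N: "equivalent_norm N" and VI: "VI_polyhedral N" and Delta: "property_Delta N"
  shows "locally_max N"
proof (rule locally_maxI[OF N])
  fix x assume x: "N x = 1"
  define F where "F = {f. f extreme_point_of support_functionals N x}"
  have "finite F" using Delta x by (simp add: F_def property_Delta_def unit_sphere_def)
  moreover obtain V where V: "open V" "x \<in> V"
    "\<forall>y\<in>V \<inter> unit_sphere N. closed_segment x y \<subseteq> unit_sphere N"
  proof -
    have "x \<in> unit_sphere N" using x by (simp add: unit_sphere_def)
    then show ?thesis using VI that unfolding VI_polyhedral_def by blast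
  qed
  moreover have "f x = 1 \<and> (\<forall>y. f y \<le> N y)" if "f \<in> F" for f
    using that support_functionals_iff[OF N x, of f] by (simp add: F_def extreme_point_of_def)
  moreover have "\<exists>f\<in>F. 1 \<le> f y" if y: "y \<in> V" "N y = 1" for y
  proof -
    have "midpoint x y \<in> closed_segment x y" by simp
    then have "midpoint x y \<in> unit_sphere N"
      using V(3) y unfolding unit_sphere_def by blast
    then have "N (midpoint x y) = 1" by (simp add: unit_sphere_def)
    then have sum: "N (x + y) = 2" by (simp add: midpoint_def equivalent_norm_scale[OF N])
    obtain f :: "'a \<Rightarrow>\<^sub>L real" where f: "f (x + y) = N (x + y)" "f extreme_point_of {f. \<forall>y. blinfun_apply f y \<le> N y}"
      by (rule norming_functional_extreme[OF N])
    have le: "f z \<le> N z" for z using f(2) by (auto simp: extreme_point_of_def)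
    have fxy: "f x = 1" "f y = 1"
      using le[of x] le[of y] x y f(1) sum by (auto simp: blinfun.add_right)
    have "f \<in> F"
      using f(2) fxy support_functionals_iff[OF N x] unfolding F_def extreme_point_of_def by blast
    then show ?thesis using fxy by (intro bexI[of _ f]) auto
  qed
  ultimately show "\<exists>F V. finite (F :: ('a \<Rightarrow>\<^sub>L real) set) \<and> open V \<and> x \<in> V \<and>
      (\<forall>f\<in>F. f x \<le> 1 \<and> (f x = 1 \<longrightarrow> (\<forall>y. f y \<le> N y))) \<and> (\<forall>y\<in>V. N y = 1 \<longrightarrow> (\<exists>f\<in>F. 1 \<le> f y))"
    by (intro exI[of _ F] exI[of _ V]) auto
qed

text \<open>One of the functionals that describe \<open>N\<close> near \<open>x\<close> takes the value one at both
  ends of the segment.\<close>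
lemma VI_polyhedral_if_locally_max:
  fixes N :: "'a::real_normed_vector \<Rightarrow> real"
  assumes N: "equivalent_norm N" and lm: "locally_max N"
  shows "VI_polyhedral N"
  unfolding VI_polyhedral_def
proof
  fix x assume "x \<in> unit_sphere N"
  then have x: "N x = 1" by (simp add: unit_sphere_def)
  obtain F :: "('a \<Rightarrow>\<^sub>L real) set" and V where F: "open V" "x \<in> V"
    "\<And>f. f \<in> F \<Longrightarrow> f x = 1 \<and> (\<forall>y. f y \<le> N y)" "\<And>y. y \<in> V \<Longrightarrow> \<exists>f\<in>F. f y = N y"
    using lm x unfolding locally_max_def by metis
  have "closed_segment x y \<subseteq> unit_sphere N" if y: "y \<in> V \<inter> unit_sphere N" for y
  proof
    fix z assume "z \<in> closed_segment x y"
    then obtain t where t: "0 \<le> t" "t \<le> 1" "z = (1 - t) *\<^sub>R x + t *\<^sub>R y" by (auto simp: in_segment)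
    obtain f where f: "f \<in> F" "f y = N y" using F(4) y by blast
    have Ny: "N y = 1" using y by (simp add: unit_sphere_def)
    have "f z = 1" using F(3)[OF f(1)] f(2) t Ny by (simp add: blinfun.add_right blinfun.scaleR_right)
    then have "1 \<le> N z" using F(3)[OF f(1)] by metis
    moreover have "N z \<le> 1"
      using equivalent_norm_triangle[OF N, of "(1 - t) *\<^sub>R x" "t *\<^sub>R y"] t x Ny
      by (simp add: equivalent_norm_scale[OF N])
    ultimately show "z \<in> unit_sphere N" by (simp add: unit_sphere_def)
  qed
  then show "\<exists>V. open V \<and> x \<in> V \<and> (\<forall>y\<in>V \<inter> unit_sphere N. closed_segment x y \<subseteq> unit_sphere N)"
    using F(1,2) by blast
qed

lemma extreme_point_of_finite_hull:
  assumes e: "g extreme_point_of S" and "convex S" "finite I" "\<And>i. i \<in> I \<Longrightarrow> a i \<in> S"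
    and c: "\<And>i. i \<in> I \<Longrightarrow> 0 \<le> c i" "sum c I = 1" "g = (\<Sum>i\<in>I. c i *\<^sub>R a i)"
  shows "g \<in> a ` I"
proof -
  have "g \<in> convex hull (a ` I)"
    unfolding c(3) using assms by (intro convex_sum convex_convex_hull) (auto intro: hull_inc)
  moreover have "convex hull (a ` I) \<subseteq> S" using assms by (intro hull_minimal) auto
  ultimately have "g extreme_point_of (convex hull (a ` I))"
    using e unfolding extreme_point_of_def by blast
  then show ?thesis by (rule extreme_point_of_convex_hull)
qed

text \<open>A support functional \<open>g\<close> at \<open>x\<close> lies below the maximum of \<open>F\<close>
  near \<open>x\<close>, and all of them agree at \<open>x\<close>. So \<open>g\<close> is nonpositive where all of
  \<open>F\<close> is, and by the Farkas lemma it is a nonnegative combination of \<open>F\<close>; its value at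
  \<open>x\<close> makes the combination convex.\<close>
lemma property_Delta_if_locally_max:
  fixes N :: "'a::real_normed_vector \<Rightarrow> real"
  assumes N: "equivalent_norm N" and lm: "locally_max N"
  shows "property_Delta N"
  unfolding property_Delta_def
proof
  fix x assume "x \<in> unit_sphere N"
  then have x: "N x = 1" by (simp add: unit_sphere_def)
  obtain F :: "('a \<Rightarrow>\<^sub>L real) set" and V where F: "finite F" "open V" "x \<in> V"
    "\<And>f. f \<in> F \<Longrightarrow> f x = 1 \<and> (\<forall>y. f y \<le> N y)" "\<And>y. y \<in> V \<Longrightarrow> \<exists>f\<in>F. f y = N y"
    using lm x unfolding locally_max_def by metis
  let ?D = "support_functionals N x"
  have D: "f \<in> ?D \<longleftrightarrow> f x = 1 \<and> (\<forall>y. f y \<le> N y)" for f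
    by (rule support_functionals_iff[OF N x])
  have "convex ?D"
  proof (rule convexI)
    fix f g and u v :: real assume *: "f \<in> ?D" "g \<in> ?D" "0 \<le> u" "0 \<le> v" "u + v = 1"
    have "u * f y + v * g y \<le> N y" for y
    proof -
      have "u * f y + v * g y \<le> u * N y + v * N y"
        using * D by (intro add_mono mult_left_mono) auto
      also have "\<dots> = N y" using *(5) by (metis distrib_right mult_1)
      finally show ?thesis .
    qed
    then show "u *\<^sub>R f + v *\<^sub>R g \<in> ?D"
      using * by (simp add: D blinfun.add_left blinfun.scaleR_left)
  qed
  have "g \<in> F" if g: "g extreme_point_of ?D" for g
  proof -
    have gD: "g x = 1" "\<And>y. g y \<le> N y" using g D by (auto simp: extreme_point_of_def)
    have "\<exists>c. (\<forall>f\<in>F. 0 \<le> c f) \<and> g = (\<Sum>f\<in>F. c f *\<^sub>R f)"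
    proof (rule Farkas[OF F(1)])
      fix z assume z: "\<And>f. f \<in> F \<Longrightarrow> f z \<le> 0"
      obtain t where t: "0 < t" "x + t *\<^sub>R z \<in> V" by (rule small_step_in_open[OF F(2,3)])
      obtain f where f: "f \<in> F" "f (x + t *\<^sub>R z) = N (x + t *\<^sub>R z)" using F(5) t by blast
      have "g (x + t *\<^sub>R z) \<le> f (x + t *\<^sub>R z)" using gD f by simp
      then have "t * g z \<le> t * f z"
        using gD F(4)[OF f(1)] by (simp add: blinfun.add_right blinfun.scaleR_right)
      then show "g z \<le> 0" using t z[OF f(1)] by simp
    qed
    then obtain c where c: "\<And>f. f \<in> F \<Longrightarrow> 0 \<le> c f" "g = (\<Sum>f\<in>F. c f *\<^sub>R f)" by blast
    have "g x = (\<Sum>f\<in>F. c f * f x)" unfolding c(2) by (simp add: blinfun.sum_left blinfun.scaleR_left)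
    also have "\<dots> = sum c F" using F(4) by (intro sum.cong) auto
    finally have "sum c F = 1" using gD by simp
    then have "g \<in> (\<lambda>f. f) ` F"
      using c F D \<open>convex ?D\<close> by (intro extreme_point_of_finite_hull[OF g, of F "\<lambda>f. f" c]) auto
    then show ?thesis by simp
  qed
  then show "finite {f. f extreme_point_of ?D}" by (intro finite_subset[OF _ F(1)]) blast
qed

section \<open>(K)-polyhedrality and dependence on finitely many coordinates\<close>

lemma LFC_if_locally_max:
  fixes N :: "'a::real_normed_vector \<Rightarrow> real"
  assumes lm: "locally_max N"
  shows "LFC N"
  unfolding LFC_def
proof
  fix x assume "x \<in> unit_sphere N"
  then have x: "N x = 1" by (simp add: unit_sphere_def)
  obtain F :: "('a \<Rightarrow>\<^sub>L real) set" and V where F: "finite F" "open V" "x \<in> V"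
    "\<And>f. f \<in> F \<Longrightarrow> f x = 1 \<and> (\<forall>y. f y \<le> N y)" "\<And>y. y \<in> V \<Longrightarrow> \<exists>f\<in>F. f y = N y"
    using lm x unfolding locally_max_def by metis
  have le: "N y \<le> N z" if y: "y \<in> V" and eq: "\<forall>f\<in>F. f y = f z" for y z
  proof -
    obtain f where f: "f \<in> F" "f y = N y" using F(5)[OF y] by blast
    have "f z \<le> N z" using F(4)[OF f(1)] by blast
    then show ?thesis using f eq by auto
  qed
  have "N y = N z" if "y \<in> V" "z \<in> V" "\<forall>f\<in>F. f y = f z" for y z
    by (intro antisym le) (use that in auto)
  then show "\<exists>U F. open U \<and> x \<in> U \<and> finite (F :: ('a \<Rightarrow>\<^sub>L real) set) \<and>
        (\<forall>y\<in>U. \<forall>z\<in>U. (\<forall>f\<in>F. blinfun_apply f y = blinfun_apply f z) \<longrightarrow> N y = N z)"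
    using F(1-3) by blast
qed

text \<open>By compactness, finitely many functionals describe \<open>N\<close> on the whole unit sphere of the
  subspace, and then they describe its unit ball by inequalities.\<close>
lemma K_polyhedral_if_locally_max:
  fixes N :: "'a::real_normed_vector \<Rightarrow> real"
  assumes N: "equivalent_norm N" and lm: "locally_max N"
  shows "K_polyhedral N"
  unfolding K_polyhedral_def
proof (intro allI impI, elim conjE exE)
  fix Y B assume Y: "subspace Y" and B: "finite B" "span B = (Y :: 'a set)"
  obtain a where a: "0 < a" "\<And>x. a * norm x \<le> N x" using equivalent_norm_bounds[OF N] by metis
  define S where "S = {y \<in> Y. N y = 1}"
  have "S = {y. N y = 1} \<inter> (cball 0 (1 / a) \<inter> span B)"
  proof -
    have "norm y \<le> 1 / a" if "N y = 1" for y
      using a(2)[of y] a(1) that by (simp add: field_simps)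
    then show ?thesis by (auto simp: S_def B(2))
  qed
  moreover have "closed {y. N y = 1}"
    by (intro closed_Collect_eq continuous_on_equivalent_norm[OF N] continuous_intros)
  ultimately have "compact S" using compact_cball_Int_span[OF B(1)] by (simp add: closed_Int_compact)
  define norms where "norms F V \<longleftrightarrow> finite F \<and> (\<forall>f\<in>F. \<forall>y. f y \<le> N y) \<and> (\<forall>y\<in>V. \<exists>f\<in>F. f y = N y)"
    for F :: "('a \<Rightarrow>\<^sub>L real) set" and V
  define \<V> where "\<V> = {V. open V \<and> (\<exists>F. norms F V)}"
  have cover: "\<exists>V\<in>\<V>. x \<in> V" if "x \<in> S" for x
  proof -
    have "N x = 1" using that by (simp add: S_def)
    then obtain F :: "('a \<Rightarrow>\<^sub>L real) set" and V where F: "finite F" "open V" "x \<in> V"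
      "\<And>f. f \<in> F \<Longrightarrow> f x = 1 \<and> (\<forall>y. f y \<le> N y)" "\<And>y. y \<in> V \<Longrightarrow> \<exists>f\<in>F. f y = N y"
      using lm unfolding locally_max_def by metis
    then have "norms F V" by (simp add: norms_def)
    then have "V \<in> \<V>" using F(2) by (auto simp: \<V>_def)
    then show ?thesis using F(3) by blast
  qed
  obtain C where C: "C \<subseteq> \<V>" "finite C" "S \<subseteq> \<Union>C"
  proof (rule compactE[OF \<open>compact S\<close>])
    show "S \<subseteq> \<Union>\<V>" using cover by blast
    show "open V" if "V \<in> \<V>" for V using that by (simp add: \<V>_def)
  qed
  have "\<forall>V\<in>C. \<exists>F. norms F V"
  proof
    fix V assume "V \<in> C"
    then have "V \<in> \<V>" using C(1) by blast
    then show "\<exists>F. norms F V" by (simp add: \<V>_def)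
  qed
  from bchoice[OF this] obtain F where F: "\<forall>V\<in>C. norms (F V) V" ..
  define G where "G = (\<Union>V\<in>C. F V)"
  have norms_F: "finite (F V)" "\<forall>f\<in>F V. \<forall>y. f y \<le> N y" "\<forall>y\<in>V. \<exists>f\<in>F V. f y = N y" if "V \<in> C" for V
    using bspec[OF F that] by (simp_all add: norms_def)
  have G: "finite G" unfolding G_def using C(2) norms_F(1) by (rule finite_UN_I)
  have G_le: "g y \<le> N y" if gG: "g \<in> G" for g y
  proof -
    obtain V where "V \<in> C" "g \<in> F V" using gG unfolding G_def by (rule UN_E)
    then show ?thesis using norms_F(2) by simp
  qed
  have norming: "\<exists>g\<in>G. g y = N y" if y: "y \<in> Y" "y \<noteq> 0" for y
  proof -
    have Ny: "0 < N y"
      using y equivalent_norm_nonneg[OF N, of y] equivalent_norm_zero_iff[OF N, of y] by auto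
    then have "y /\<^sub>R N y \<in> S"
      using y Y by (simp add: S_def subspace_scale equivalent_norm_scale[OF N])
    then obtain V where V: "V \<in> C" "y /\<^sub>R N y \<in> V" using C(3) by blast
    from bspec[OF norms_F(3)[OF V(1)] V(2)] obtain g where "g \<in> F V" "g (y /\<^sub>R N y) = N (y /\<^sub>R N y)" ..
    then have "g \<in> G" "g (y /\<^sub>R N y) = N (y /\<^sub>R N y)" using V(1) by (auto simp: G_def)
    then have "g y = N y"
      using Ny by (auto simp: equivalent_norm_scale[OF N] blinfun.scaleR_right inverse_eq_divide)
    then show ?thesis using \<open>g \<in> G\<close> by blast
  qed
  have "unit_ball N \<inter> Y = {y \<in> Y. \<forall>g\<in>G. g y \<le> 1}"
  proof (intro equalityI subsetI)
    fix y assume "y \<in> unit_ball N \<inter> Y"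
    then show "y \<in> {y \<in> Y. \<forall>g\<in>G. g y \<le> 1}" using G_le by (auto simp: unit_ball_def intro: order_trans)
  next
    fix y assume y: "y \<in> {y \<in> Y. \<forall>g\<in>G. g y \<le> 1}"
    show "y \<in> unit_ball N \<inter> Y"
    proof (cases "y = 0")
      case True
      then show ?thesis using y equivalent_norm_zero_iff[OF N, of 0] by (simp add: unit_ball_def)
    next
      case False
      then obtain g where "g \<in> G" "g y = N y" using norming y by blast
      then show ?thesis using y by (auto simp: unit_ball_def)
    qed
  qed
  moreover have "polytope {y \<in> Y. \<forall>g\<in>G. g y \<le> 1}"
  proof (rule polytope_finite_inequalities[OF G _ Y])
    show "linear (blinfun_apply g)" for g :: "'a \<Rightarrow>\<^sub>L real"
      by (intro bounded_linear.linear blinfun.bounded_linear_right)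
    fix d assume d: "d \<in> Y" "d \<noteq> 0"
    then have "0 < N d"
      using equivalent_norm_nonneg[OF N, of d] equivalent_norm_zero_iff[OF N, of d] by auto
    then show "\<exists>g\<in>G. 0 < g d" using norming[OF d] by force
  qed
  ultimately show "polytope (unit_ball N \<inter> Y)" by simp
qed

text \<open>With \<open>F\<close> the coordinates near \<open>x\<close>, a functional that norms a point near
  \<open>x\<close> must vanish wherever all of \<open>F\<close> vanishes, so it lies in \<open>span F\<close>. The
  subspace \<open>Y\<close> contains \<open>x\<close> and is large enough for \<open>span F\<close> to be
  determined by its values on \<open>Y\<close>. The functionals of \<open>span F\<close> below \<open>N\<close> on
  \<open>Y\<close> are given by one inequality for each vertex of the unit ball of \<open>Y\<close>; they form a
  polytope whose vertices \<open>W\<close> norm all points near \<open>x\<close>. That a vertex \<open>w\<close>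
  with \<open>w x = 1\<close> lies below \<open>N\<close> not only on \<open>Y\<close> follows by moving from
  \<open>x\<close> slightly in a direction \<open>y\<close> and replacing \<open>y\<close> by a vector of
  \<open>Y\<close> with the same coordinates.\<close>
lemma locally_max_if_K_LFC:
  fixes N :: "'a::real_normed_vector \<Rightarrow> real"
  assumes N: "equivalent_norm N" and K: "K_polyhedral N" and LFC: "LFC N"
  shows "locally_max N"
proof (rule locally_maxI[OF N])
  fix x assume x: "N x = 1"
  obtain U and F :: "('a \<Rightarrow>\<^sub>L real) set" where F: "open U" "x \<in> U" "finite F"
    "\<forall>y\<in>U. \<forall>z\<in>U. (\<forall>f\<in>F. blinfun_apply f y = blinfun_apply f z) \<longrightarrow> N y = N z"
  proof -
    have "x \<in> unit_sphere N" using x by (simp add: unit_sphere_def)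
    from LFC[unfolded LFC_def, THEN bspec, OF this] show ?thesis by (elim exE conjE) (rule that)
  qed
  obtain E where E: "finite E" "\<And>u. \<exists>e\<in>span E. \<forall>f\<in>F. f e = f u"
    using finite_separating_family[OF F(3)] by blast
  define Y where "Y = span (insert x E)"
  have Y: "subspace Y" "x \<in> Y" by (auto simp: Y_def subspace_span intro: span_base)
  have EY: "span E \<subseteq> Y" unfolding Y_def by (intro span_mono) auto
  obtain A where A: "finite A" "unit_ball N \<inter> Y = convex hull A"
    using K E(1) Y(1) unfolding K_polyhedral_def polytope_def Y_def by (metis finite_insert)
  have Asub: "A \<subseteq> unit_ball N \<inter> Y" unfolding A(2) by (rule hull_subset)
  have lift: "\<exists>e\<in>span E. \<forall>f\<in>span F. f e = f u" for u
  proof -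
    obtain e where e: "e \<in> span E" "\<forall>f\<in>F. f e = f u" using E(2) by blast
    have "f e = f u" if "f \<in> span F" for f
      using that
    proof (induction rule: span_induct_alt)
      case (step c g h)
      then show ?case using e by (simp add: blinfun.add_left blinfun.scaleR_left)
    qed simp
    with e show ?thesis by blast
  qed
  \<comment> \<open>The vertices of the unit ball of \<open>Y\<close> decide whether a functional lies below \<open>N\<close> on \<open>Y\<close>.\<close>
  have le_on_Y: "f y \<le> N y" if f: "\<And>a. a \<in> A \<Longrightarrow> f a \<le> 1" and y: "y \<in> Y" for y and f :: "'a \<Rightarrow>\<^sub>L real"
  proof (cases "y = 0")
    case False
    then have Ny: "0 < N y"
      using equivalent_norm_nonneg[OF N, of y] equivalent_norm_zero_iff[OF N, of y] by auto
    then have "y /\<^sub>R N y \<in> convex hull A"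
      unfolding A(2)[symmetric] using y Y(1)
      by (simp add: unit_ball_def subspace_scale equivalent_norm_scale[OF N])
    moreover have "convex {z. f z \<le> 1}"
    proof (rule convexI)
      fix p q and u v :: real
      assume *: "p \<in> {z. f z \<le> 1}" "q \<in> {z. f z \<le> 1}" "0 \<le> u" "0 \<le> v" "u + v = 1"
      then have "u * f p + v * f q \<le> u * 1 + v * 1" by (intro add_mono mult_left_mono) auto
      then show "u *\<^sub>R p + v *\<^sub>R q \<in> {z. f z \<le> 1}"
        using * by (simp add: blinfun.add_right blinfun.scaleR_right)
    qed
    ultimately have "f (y /\<^sub>R N y) \<le> 1"
      using hull_minimal[of A "{z. f z \<le> 1}" convex] f by blast
    then show ?thesis using Ny by (simp add: blinfun.scaleR_right field_simps)
  qed (simp add: equivalent_norm_nonneg[OF N])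
  define P where "P = {f \<in> span F. \<forall>a\<in>A. f a \<le> 1}"
  have "polytope P"
    unfolding P_def
  proof (rule polytope_finite_inequalities[OF A(1) _ subspace_span])
    show "linear (\<lambda>f. blinfun_apply f a)" for a :: 'a
      by (intro bounded_linear.linear blinfun.bounded_linear_left)
    fix d :: "'a \<Rightarrow>\<^sub>L real" assume d: "d \<in> span F" "d \<noteq> 0"
    show "\<exists>a\<in>A. 0 < d a"
    proof (rule ccontr)
      assume "\<not> (\<exists>a\<in>A. 0 < d a)"
      then have neg: "\<And>a. a \<in> A \<Longrightarrow> d a \<le> 0" by force
      have nonpos: "d y \<le> 0" if y: "y \<in> Y" for y
      proof (rule ccontr)
        assume "\<not> d y \<le> 0"
        then have pos: "0 < d y" by simp
        \<comment> \<open>All nonnegative multiples of \<open>d\<close> lie below \<open>N\<close> on \<open>Y\<close>; this multiple has the value \<open>N y + 1\<close> at \<open>y\<close>.\<close>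
        define c where "c = (N y + 1) / d y"
        have c: "0 < c" using pos equivalent_norm_nonneg[OF N, of y] by (auto simp: c_def intro: divide_pos_pos)
        have "(c *\<^sub>R d) y \<le> N y"
          using neg c y by (intro le_on_Y) (auto simp: blinfun.scaleR_left mult_le_0_iff intro: order_trans[of _ 0])
        then show False using pos by (simp add: blinfun.scaleR_left c_def)
      qed
      have zero: "d y = 0" if y: "y \<in> Y" for y
        using nonpos[OF y] nonpos[OF subspace_neg[OF Y(1) y]] by (simp add: blinfun.minus_right)
      have "d u = 0" for u
      proof -
        obtain e where e: "e \<in> span E" "\<forall>f\<in>span F. f e = f u" using lift by blast
        then have "d u = d e" using d(1) by simp
        also have "\<dots> = 0" using e(1) EY zero by blast
        finally show ?thesis .
      qed
      then show False using d(2) by (metis blinfun_eqI blinfun.zero_left)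
    qed
  qed
  then obtain W where W: "finite W" "P = convex hull W" by (auto simp: polytope_def)
  have WP: "W \<subseteq> P" unfolding W(2) by (rule hull_subset)
  have "w x \<le> 1" if "w \<in> W" for w
    using le_on_Y[of w x] that WP Y(2) x by (auto simp: P_def)
  moreover have "w y \<le> N y" if w: "w \<in> W" "w x = 1" for w y
  proof -
    obtain e where e: "e \<in> span E" "\<forall>f\<in>span F. f e = f y" using lift by blast
    obtain t where t: "0 < t" "x + t *\<^sub>R y \<in> U" "x + t *\<^sub>R e \<in> U"
    proof -
      obtain s where s: "0 < s" "ball x s \<subseteq> U" using F(1,2) by (meson openE)
      define t where "t = s / (norm y + norm e + 1)"
      have p: "0 < norm y + norm e + 1" by (simp add: add_nonneg_pos)
      have t: "0 < t" using s p by (simp add: t_def)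
      have "t * (norm y + norm e + 1) = s" using p by (simp add: t_def)
      then have "t * norm y + t * norm e + t = s" by (simp add: algebra_simps)
      moreover have "0 \<le> t * norm y" "0 \<le> t * norm e" using t by auto
      ultimately have "t * norm y < s" "t * norm e < s" using t by linarith+
      then have "x + t *\<^sub>R y \<in> ball x s" "x + t *\<^sub>R e \<in> ball x s" using t by (auto simp: dist_norm)
      then show ?thesis using that t s by blast
    qed
    have "x + t *\<^sub>R e \<in> Y" using Y EY e(1) by (intro subspace_add subspace_scale) auto
    then have "w (x + t *\<^sub>R e) \<le> N (x + t *\<^sub>R e)"
      using le_on_Y[of w] w(1) WP by (auto simp: P_def)
    also have "\<dots> = N (x + t *\<^sub>R y)"
    proof -
      have "\<forall>f\<in>F. f (x + t *\<^sub>R e) = f (x + t *\<^sub>R y)"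
        using e(2) by (simp add: blinfun.add_right blinfun.scaleR_right span_base)
      then show ?thesis using F(4) t(2,3) by blast
    qed
    also have "\<dots> \<le> 1 + t * N y"
      using equivalent_norm_triangle[OF N, of x "t *\<^sub>R y"] x t by (simp add: equivalent_norm_scale[OF N])
    finally have "t * w y \<le> t * N y"
      using e(2) w WP by (auto simp: blinfun.add_right blinfun.scaleR_right P_def)
    then show ?thesis using t by simp
  qed
  moreover have "\<exists>w\<in>W. 1 \<le> w y" if y: "y \<in> U" "N y = 1" for y
  proof -
    obtain f :: "'a \<Rightarrow>\<^sub>L real" where f: "f y = N y" "f extreme_point_of {f. \<forall>y. blinfun_apply f y \<le> N y}"
      by (rule norming_functional_extreme[OF N])
    have le: "f z \<le> N z" for z using f(2) by (auto simp: extreme_point_of_def)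
    \<comment> \<open>Moving \<open>y\<close> slightly in a direction \<open>z\<close> killed by \<open>F\<close> does not change \<open>N\<close>, and \<open>f \<le> N\<close> with equality at \<open>y\<close>.\<close>
    have "f \<in> span F"
    proof (rule mem_span_if_kernel[OF F(3)])
      fix z assume z: "\<And>g. g \<in> F \<Longrightarrow> g z = 0"
      obtain t where t: "0 < t" "y + t *\<^sub>R z \<in> U" "y - t *\<^sub>R z \<in> U"
        by (rule small_step_in_open[OF F(1) y(1)])
      have "\<forall>f\<in>F. f (y + t *\<^sub>R z) = f y" "\<forall>f\<in>F. f (y - t *\<^sub>R z) = f y"
        using z by (simp_all add: blinfun.add_right blinfun.diff_right blinfun.scaleR_right)
      then have "N (y + t *\<^sub>R z) = N y" "N (y - t *\<^sub>R z) = N y" using F(4) t y(1) by blast+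
      then have "f y + t * f z \<le> N y" "f y - t * f z \<le> N y"
        using le[of "y + t *\<^sub>R z"] le[of "y - t *\<^sub>R z"]
        by (auto simp: blinfun.add_right blinfun.diff_right blinfun.scaleR_right)
      then have "t * f z = 0" using f(1) by simp
      then show "f z = 0" using t(1) by simp
    qed
    moreover have "f a \<le> 1" if "a \<in> A" for a
      using le[of a] that Asub by (auto simp: unit_ball_def intro: order_trans)
    ultimately have "f \<in> convex hull W" unfolding W(2)[symmetric] by (simp add: P_def)
    show ?thesis
    proof (rule ccontr)
      assume "\<not> ?thesis"
      then have "W \<subseteq> {w. blinfun_apply w y < 1}" by force
      moreover have "convex {w :: 'a \<Rightarrow>\<^sub>L real. blinfun_apply w y < 1}"
      proof -
        have "linear (\<lambda>w :: 'a \<Rightarrow>\<^sub>L real. w y)"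
          by (intro bounded_linear.linear blinfun.bounded_linear_left)
        then have "convex ((\<lambda>w :: 'a \<Rightarrow>\<^sub>L real. w y) -` {..<1})"
          by (rule convex_linear_vimage) simp
        then show ?thesis by (rule back_subst[of convex]) auto
      qed
      ultimately have "f y < 1" using \<open>f \<in> convex hull W\<close> hull_minimal[of W _ convex] by blast
      then show False using f(1) y(2) by simp
    qed
  qed
  ultimately show "\<exists>F V. finite (F :: ('a \<Rightarrow>\<^sub>L real) set) \<and> open V \<and> x \<in> V \<and>
      (\<forall>f\<in>F. f x \<le> 1 \<and> (f x = 1 \<longrightarrow> (\<forall>y. f y \<le> N y))) \<and> (\<forall>y\<in>V. N y = 1 \<longrightarrow> (\<exists>f\<in>F. 1 \<le> f y))"
    using W(1) F(1,2) by (intro exI[of _ W] exI[of _ U]) auto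
qed

section \<open>From a norm to a tiling\<close>

text \<open>A finite union of closed sets with empty interior has empty interior, so the remaining pieces are dense
  in \<open>W\<close>; and their union is closed.\<close>
lemma closure_subset_nonmeagre_pieces:
  fixes W :: "'a::topological_space set"
  assumes W: "open W" and fin: "finite \<A>" and closed: "\<And>A. A \<in> \<A> \<Longrightarrow> closed A" and cover: "W \<subseteq> \<Union>\<A>"
  shows "closure W \<subseteq> \<Union>{A \<in> \<A>. interior A \<noteq> {}}"
proof -
  let ?C = "\<Union>{A \<in> \<A>. interior A \<noteq> {}}"
  let ?B = "{A \<in> \<A>. interior A = {}}"
  have "finite \<B> \<Longrightarrow> \<B> \<subseteq> ?B \<Longrightarrow> interior (\<Union>\<B>) = {}" for \<B>
  proof (induction \<B> rule: finite_induct)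
    case (insert A \<B>)
    then have "interior (A \<union> \<Union>\<B>) = interior A"
      using closed by (intro interior_closed_Un_empty_interior) auto
    then show ?case using insert by auto
  qed simp
  then have "interior (\<Union>?B) = {}" using fin by simp
  moreover have C: "closed ?C" using fin closed by (intro closed_Union) auto
  have "W - ?C \<subseteq> \<Union>?B"
  proof
    fix x assume x: "x \<in> W - ?C"
    then obtain A where "A \<in> \<A>" "x \<in> A" using cover by auto
    then show "x \<in> \<Union>?B" using x by auto
  qed
  then have "W - ?C \<subseteq> interior (\<Union>?B)" by (rule interior_maximal[OF _ open_Diff[OF W C]])
  ultimately have "W \<subseteq> ?C" by blast
  then show ?thesis using C by (rule closure_minimal)
qed

lemma blinfun_zero_if_constant_on_open:
  fixes h :: "'a::real_normed_vector \<Rightarrow>\<^sub>L real"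
  assumes "open G" "p \<in> G" "\<And>y. y \<in> G \<Longrightarrow> h y = c"
  shows "h = 0"
proof (rule blinfun_eqI)
  fix u
  obtain t where t: "0 < t" "p + t *\<^sub>R u \<in> G" by (rule small_step_in_open[OF assms(1,2)])
  have "t * h u = 0"
    using assms(3)[OF t(2)] assms(3)[OF assms(2)] by (simp add: blinfun.add_right blinfun.scaleR_right)
  then show "h u = blinfun_apply 0 u" using t(1) by simp
qed

lemma blinfun_eq_if_agree_on_open:
  fixes f g :: "'a::real_normed_vector \<Rightarrow>\<^sub>L real"
  assumes "open G" "p \<in> G" "\<And>y. y \<in> G \<Longrightarrow> f y = g y"
  shows "f = g"
  using blinfun_zero_if_constant_on_open[of G p "f - g" 0] assms by (simp add: blinfun.diff_left)

text \<open>The tiles outside the unit ball are those of these sets with \<open>n \<ge> 1\<close> that have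
  interior points. The layer \<open>n = 0\<close> is left undivided: all cones meet at the origin, where cutting
  the unit ball would in general destroy local finiteness.\<close>
definition shell_piece :: "('a::real_normed_vector \<Rightarrow> real) \<Rightarrow> ('a \<Rightarrow>\<^sub>L real) \<Rightarrow> nat \<Rightarrow> 'a set" where
  "shell_piece N f n = {z. f z = N z \<and> real n \<le> N z \<and> N z \<le> real n + 1}"

lemma closed_shell_piece:
  assumes "equivalent_norm N"
  shows "closed (shell_piece N f n)"
  unfolding shell_piece_def
  by (intro closed_Collect_conj closed_Collect_eq closed_Collect_le continuous_on_equivalent_norm[OF assms]
      continuous_intros)

text \<open>Since \<open>f \<le> N\<close>, the equation \<open>f z = N z\<close> is the convex condition
  \<open>N z \<le> f z\<close>, and on its solutions the bounds on \<open>N\<close> are bounds on the linear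
  functional \<open>f\<close>.\<close>
lemma convex_shell_piece:
  fixes f :: "'a::real_normed_vector \<Rightarrow>\<^sub>L real"
  assumes N: "equivalent_norm N" and f: "\<And>y. f y \<le> N y"
  shows "convex (shell_piece N f n)"
proof (rule convexI)
  fix x y and u v :: real
  assume xy: "x \<in> shell_piece N f n" "y \<in> shell_piece N f n" and uv: "0 \<le> u" "0 \<le> v" "u + v = 1"
  let ?z = "u *\<^sub>R x + v *\<^sub>R y"
  have fz: "f ?z = u * f x + v * f y" by (simp add: blinfun.add_right blinfun.scaleR_right)
  have "N ?z \<le> u * N x + v * N y"
    using equivalent_norm_triangle[OF N, of "u *\<^sub>R x" "v *\<^sub>R y"] uv by (simp add: equivalent_norm_scale[OF N])
  also have "\<dots> = f ?z" using xy fz by (simp add: shell_piece_def)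
  finally have eq: "f ?z = N ?z" using f[of ?z] by simp
  have "u * real n + v * real n \<le> f ?z"
    unfolding fz using xy uv by (intro add_mono mult_left_mono) (auto simp: shell_piece_def)
  moreover have "u * real n + v * real n = real n" using uv(3) by (metis distrib_right mult_1)
  moreover have "f ?z \<le> u * (real n + 1) + v * (real n + 1)"
    unfolding fz using xy uv by (intro add_mono mult_left_mono) (auto simp: shell_piece_def)
  moreover have "u * (real n + 1) + v * (real n + 1) = real n + 1" using uv(3) by (metis distrib_right mult_1)
  ultimately show "?z \<in> shell_piece N f n" using eq by (simp add: shell_piece_def)
qed

text \<open>Overlapping tiles would give an open set on which two functionals agree with \<open>N\<close>, hence
  agree with each other, or on which a single nonzero functional is constant. A tile that meets a neighbourhood on
  which \<open>N\<close> is the maximum of a finite set \<open>F\<close> has interior points there, and then its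
  functional coincides on an open set with a member of \<open>F\<close>; so the tiling is locally finite. Pieces
  with empty interior can be left out because finitely many of them cover no open set.\<close>
lemma locally_finite_tiling_if_locally_max:
  fixes N :: "'a::real_normed_vector \<Rightarrow> real"
  assumes N: "equivalent_norm N" and lm: "locally_max N"
  shows "\<exists>T :: 'a set set. tiling T \<and> locally_finite_in euclidean T \<and> (\<forall>K\<in>T. bounded K)"
proof -
  define P where "P f n \<longleftrightarrow> 1 \<le> n \<and> (\<forall>y. f y \<le> N y) \<and> interior (shell_piece N f n) \<noteq> {}"
    for f :: "'a \<Rightarrow>\<^sub>L real" and n
  define T where "T = insert (unit_ball N) {shell_piece N f n | f n. P f n}"
  have T_cases: "K = unit_ball N \<or> (\<exists>f n. K = shell_piece N f n \<and> P f n)" if "K \<in> T" for K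
    using that by (auto simp: T_def)
  note cont = continuous_on_equivalent_norm[OF N]
  obtain a where a: "0 < a" "\<And>x. a * norm x \<le> N x" using equivalent_norm_bounds[OF N] by metis
  have N0: "N 0 = 0" using equivalent_norm_zero_iff[OF N] by simp
  have bounded: "bounded K" if "K \<in> T" for K
  proof -
    have *: "bounded {z. N z \<le> c}" for c
      using a by (intro boundedI[of _ "c / a"]) (auto simp: field_simps intro: order_trans)
    show ?thesis
      using T_cases[OF that]
      by (elim disjE exE conjE) (auto simp: unit_ball_def shell_piece_def intro: bounded_subset[OF *])
  qed
  have ball: "convex_body (unit_ball N)"
    unfolding convex_body_def
  proof (intro conjI)
    show "closed (unit_ball N)" unfolding unit_ball_def by (intro closed_Collect_le cont continuous_intros)
    show "convex (unit_ball N)"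
    proof (rule convexI)
      fix x y and u v :: real
      assume *: "x \<in> unit_ball N" "y \<in> unit_ball N" "0 \<le> u" "0 \<le> v" "u + v = 1"
      have "N (u *\<^sub>R x + v *\<^sub>R y) \<le> u * N x + v * N y"
        using equivalent_norm_triangle[OF N, of "u *\<^sub>R x" "v *\<^sub>R y"] * by (simp add: equivalent_norm_scale[OF N])
      also have "\<dots> \<le> u * 1 + v * 1" using * by (intro add_mono mult_left_mono) (auto simp: unit_ball_def)
      finally show "u *\<^sub>R x + v *\<^sub>R y \<in> unit_ball N" using * by (simp add: unit_ball_def)
    qed
    have "open {z. N z < 1}" by (intro open_Collect_less cont continuous_intros)
    then have "0 \<in> interior (unit_ball N)"
      using N0 by (intro interiorI[of "{z. N z < 1}"]) (auto simp: unit_ball_def)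
    then show "interior (unit_ball N) \<noteq> {}" by blast
  qed
  have body: "convex_body K" if "K \<in> T" for K
    using T_cases[OF that] ball closed_shell_piece[OF N] convex_shell_piece[OF N]
    unfolding convex_body_def P_def by blast
  have cover: "z \<in> \<Union>T" for z
  proof (cases "N z \<le> 1")
    case True
    then show ?thesis by (auto simp: T_def unit_ball_def)
  next
    case False
    define n where "n = nat \<lfloor>N z\<rfloor>"
    have n: "1 \<le> n" "real n \<le> N z" "N z < real n + 1"
      using False by (auto simp: n_def le_nat_iff le_floor_iff)
    have "z \<noteq> 0" using False N0 by auto
    then obtain F :: "('a \<Rightarrow>\<^sub>L real) set" and V where F: "finite F" "open V" "z \<in> V"
      "\<And>f y. f \<in> F \<Longrightarrow> f y \<le> N y" "\<And>y. y \<in> V \<Longrightarrow> \<exists>f\<in>F. f y = N y"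
      by (rule locally_maxE[OF N lm]) blast
    \<comment> \<open>The point \<open>z\<close> may lie on the inner boundary of the layer; an open set in the layer with \<open>z\<close> in
      its closure is enough to find a piece that has interior points and contains \<open>z\<close>.\<close>
    define W where "W = V \<inter> {y. real n < N y} \<inter> {y. N y < real n + 1}"
    have "open W" unfolding W_def by (intro open_Int F open_Collect_less cont continuous_intros)
    moreover have "W \<subseteq> \<Union>((\<lambda>f. shell_piece N f n) ` F)"
      using F(5) by (force simp: W_def shell_piece_def)
    ultimately have sub: "closure W \<subseteq> \<Union>{A \<in> (\<lambda>f. shell_piece N f n) ` F. interior A \<noteq> {}}"
      using F(1) closed_shell_piece[OF N] by (intro closure_subset_nonmeagre_pieces) auto
    have "z \<in> closure W"
      unfolding closure_iff_nhds_not_empty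
    proof (intro allI impI)
      fix A S assume S: "S \<subseteq> A" "open S" "z \<in> S"
      have "open (S \<inter> V \<inter> {y. N y < real n + 1})"
        by (intro open_Int S F open_Collect_less cont continuous_intros)
      then obtain t where t: "0 < t" "z + t *\<^sub>R z \<in> S \<inter> V \<inter> {y. N y < real n + 1}"
        using small_step_in_open[of _ z z] S(3) F(3) n(3) by blast
      have "z + t *\<^sub>R z = (1 + t) *\<^sub>R z" by (simp add: algebra_simps)
      then have "N (z + t *\<^sub>R z) = N z + t * N z"
        using t(1) by (simp only: equivalent_norm_scale[OF N]) (simp add: algebra_simps)
      moreover have "0 < t * N z" using t False by simp
      ultimately have "real n < N (z + t *\<^sub>R z)" using n(2) by linarith
      then have "z + t *\<^sub>R z \<in> W" using t(2) by (simp add: W_def)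
      then show "W \<inter> A \<noteq> {}" using t S by blast
    qed
    then obtain f where f: "f \<in> F" "z \<in> shell_piece N f n" "interior (shell_piece N f n) \<noteq> {}"
    proof -
      from subsetD[OF sub \<open>z \<in> closure W\<close>] show ?thesis using that by auto
    qed
    then have "P f n" using F(4) n(1) by (simp add: P_def)
    then have "shell_piece N f n \<in> T" unfolding T_def by blast
    then show ?thesis using f by blast
  qed
  have no_overlap: False
    if "open G" "p \<in> G" "\<And>y. y \<in> G \<Longrightarrow> f y = N y \<and> N y = c" "0 < c"
    for G p c and f :: "'a \<Rightarrow>\<^sub>L real"
  proof -
    have "f = 0" by (rule blinfun_zero_if_constant_on_open[OF that(1,2)]) (use that(3) in simp)
    then show False using that(3)[OF that(2)] that(4) by simp
  qed
  have disjoint: "pairwise (\<lambda>K L. interior K \<inter> interior L = {}) T"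
  proof (rule pairwiseI, rule ccontr)
    fix K L assume KL: "K \<in> T" "L \<in> T" "K \<noteq> L" and "interior K \<inter> interior L \<noteq> {}"
    then obtain p where p: "p \<in> interior K \<inter> interior L" by blast
    have G: "open (interior K \<inter> interior L)" by auto
    have K: "y \<in> K" and L: "y \<in> L" if "y \<in> interior K \<inter> interior L" for y
      using that interior_subset by blast+
    have ball_piece: False if "P f n" "{unit_ball N, shell_piece N f n} = {K, L}" for f n
    proof (rule no_overlap[OF G p, of f 1])
      fix y assume "y \<in> interior K \<inter> interior L"
      then have "y \<in> unit_ball N" "y \<in> shell_piece N f n" using K L that(2) by blast+
      then show "f y = N y \<and> N y = 1" using that(1) by (auto simp: unit_ball_def shell_piece_def P_def)
    qed simp
    consider "K = unit_ball N \<or> L = unit_ball N" |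
      f g n m where "K = shell_piece N f n" "L = shell_piece N g m" "P f n" "P g m"
      using T_cases[OF KL(1)] T_cases[OF KL(2)] by blast
    then show False
    proof cases
      case 1
      then obtain f n where "P f n" "{unit_ball N, shell_piece N f n} = {K, L}"
        using T_cases[OF KL(1)] T_cases[OF KL(2)] KL(3) by (metis insert_commute)
      then show False by (rule ball_piece)
    next
      case 2
      have *: "f y = N y" "g y = N y" "real n \<le> N y" "N y \<le> real n + 1" "real m \<le> N y" "N y \<le> real m + 1"
        if "y \<in> interior K \<inter> interior L" for y
        using K[OF that] L[OF that] 2(1,2) by (auto simp: shell_piece_def)
      have "f = g" using * by (intro blinfun_eq_if_agree_on_open[OF G p]) simp
      then have "n \<noteq> m" using 2 KL(3) by auto
      then have "f y = N y \<and> N y = real (max n m)" if "y \<in> interior K \<inter> interior L" for y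
        using *[OF that] by linarith
      moreover have "0 < real (max n m)" using \<open>n \<noteq> m\<close> by auto
      ultimately show False by (rule no_overlap[OF G p])
    qed
  qed
  have "\<exists>V. open V \<and> z \<in> V \<and> finite {K \<in> T. K \<inter> V \<noteq> {}}" for z
  proof (cases "N z < 1")
    case True
    have "open {y. N y < 1}" by (intro open_Collect_less cont continuous_intros)
    moreover have "{K \<in> T. K \<inter> {y. N y < 1} \<noteq> {}} \<subseteq> {unit_ball N}"
    proof
      fix K assume K: "K \<in> {K \<in> T. K \<inter> {y. N y < 1} \<noteq> {}}"
      show "K \<in> {unit_ball N}" using K T_cases[of K] by (auto simp: shell_piece_def P_def)
    qed
    then have "finite {K \<in> T. K \<inter> {y. N y < 1} \<noteq> {}}" by (rule finite_subset) simp
    ultimately show ?thesis using True by blast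
  next
    case False
    then have "z \<noteq> 0" using N0 by auto
    then obtain F :: "('a \<Rightarrow>\<^sub>L real) set" and V where F: "finite F" "open V" "z \<in> V"
      "\<And>f y. f \<in> F \<Longrightarrow> f y \<le> N y" "\<And>y. y \<in> V \<Longrightarrow> \<exists>f\<in>F. f y = N y"
      by (rule locally_maxE[OF N lm]) blast
    obtain m :: nat where m: "N z < real m" using reals_Archimedean2 by blast
    define Z where "Z = V \<inter> {y. N y < real m}"
    have Z: "open Z" "z \<in> Z" using F(2,3) m by (auto simp: Z_def intro!: open_Int open_Collect_less cont)
    have "{K \<in> T. K \<inter> Z \<noteq> {}} \<subseteq> insert (unit_ball N) ((\<lambda>(f, n). shell_piece N f n) ` (F \<times> {..<m}))"
    proof
      fix K assume "K \<in> {K \<in> T. K \<inter> Z \<noteq> {}}"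
      then have K: "K \<in> T" "K \<inter> Z \<noteq> {}" by auto
      show "K \<in> insert (unit_ball N) ((\<lambda>(f, n). shell_piece N f n) ` (F \<times> {..<m}))"
      proof (cases "K = unit_ball N")
        case False
        then obtain f n where fn: "K = shell_piece N f n" "P f n" using T_cases[OF K(1)] by blast
        have n: "n < m" using K(2) by (auto simp: fn(1) shell_piece_def Z_def)
        have "convex_body K" using body K(1) by blast
        then have "K \<subseteq> closure (interior K)"
          by (intro convex_body_subset_closure_interior) (auto simp: convex_body_def)
        then have "closure (interior K) \<inter> Z \<noteq> {}" using K(2) by blast
        then have "Z \<inter> interior K \<noteq> {}" using open_Int_closure_eq_empty[OF Z(1)] by blast
        then obtain p where p: "p \<in> Z \<inter> interior K" by blast
        have G: "open (Z \<inter> interior K)" using Z(1) by auto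
        have "Z \<inter> interior K \<subseteq> \<Union>((\<lambda>g. {y. blinfun_apply g y = f y}) ` F)"
          using F(5) interior_subset[of K] by (force simp: Z_def fn(1) shell_piece_def)
        then have "closure (Z \<inter> interior K) \<subseteq> \<Union>{A \<in> (\<lambda>g. {y. blinfun_apply g y = f y}) ` F. interior A \<noteq> {}}"
          using F(1) by (intro closure_subset_nonmeagre_pieces[OF G])
            (auto intro!: closed_Collect_eq continuous_intros)
        then obtain g where g: "g \<in> F" "interior {y. blinfun_apply g y = f y} \<noteq> {}"
          using p closure_subset by blast
        then obtain q where q: "q \<in> interior {y. blinfun_apply g y = f y}" by blast
        have "g = f"
          by (rule blinfun_eq_if_agree_on_open[OF open_interior q]) (use interior_subset in blast)
        then show ?thesis using fn(1) g(1) n by auto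
      qed simp
    qed
    then have "finite {K \<in> T. K \<inter> Z \<noteq> {}}" by (rule finite_subset) (use F(1) in auto)
    then show ?thesis using Z by blast
  qed
  then have "locally_finite_in euclidean T" by (auto simp: locally_finite_in_def)
  moreover have "tiling T" using body cover disjoint by (auto simp: tiling_def)
  ultimately show ?thesis using bounded by blast
qed

section \<open>From a tiling to a norm\<close>

text \<open>Separate \<open>K\<close> from each of the finitely many other tiles that meet a neighbourhood of
  \<open>x\<close>. A point \<open>y\<close> of the neighbourhood that satisfies the inequalities becomes strictly
  feasible when it is moved slightly towards \<open>c\<close>; it is then in no other tile and hence in
  \<open>K\<close>, which is closed.\<close>
lemma tile_local_inequalities:
  fixes T :: "'a::real_normed_vector set set"
  assumes T: "tiling T" "locally_finite_in euclidean T" and K: "K \<in> T" "c \<in> interior K"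
  obtains G :: "('a \<Rightarrow>\<^sub>L real) set" and V where "finite G" "open V" "x \<in> V"
    "\<And>g k. g \<in> G \<Longrightarrow> k \<in> K \<Longrightarrow> g (k - c) \<le> 1" "\<And>y. y \<in> V \<Longrightarrow> (\<And>g. g \<in> G \<Longrightarrow> g (y - c) \<le> 1) \<Longrightarrow> y \<in> K"
proof -
  have bodies: "\<And>L. L \<in> T \<Longrightarrow> convex_body L" and cover: "\<Union>T = UNIV"
    and disj: "\<And>L. L \<in> T \<Longrightarrow> L \<noteq> K \<Longrightarrow> interior K \<inter> interior L = {}"
    using T(1) K(1) by (auto simp: tiling_def pairwise_def)
  obtain V where V: "open V" "x \<in> V" "finite {L \<in> T. L \<inter> V \<noteq> {}}"
    using T(2) by (auto simp: locally_finite_in_def)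
  define \<L> where "\<L> = {L \<in> T. L \<inter> V \<noteq> {}} - {K}"
  have "\<exists>g :: 'a \<Rightarrow>\<^sub>L real. (\<forall>k\<in>K. g (k - c) \<le> 1) \<and> (\<forall>l\<in>L. 1 \<le> g (l - c))" if "L \<in> \<L>" for L
  proof -
    have L: "L \<in> T" "L \<noteq> K" using that by (auto simp: \<L>_def)
    obtain g :: "'a \<Rightarrow>\<^sub>L real" where "\<And>k. k \<in> K \<Longrightarrow> g (k - c) \<le> 1" "\<And>l. l \<in> L \<Longrightarrow> 1 \<le> g (l - c)"
    proof (rule separating_functional[of K c L])
      show "convex K" "c \<in> interior K" "convex L" "interior L \<noteq> {}" "interior K \<inter> interior L = {}"
        using bodies[OF L(1)] bodies[OF K(1)] K(2) disj[OF L] by (simp_all add: convex_body_def)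
    qed blast
    then show ?thesis by blast
  qed
  then have "\<forall>L\<in>\<L>. \<exists>g :: 'a \<Rightarrow>\<^sub>L real. (\<forall>k\<in>K. g (k - c) \<le> 1) \<and> (\<forall>l\<in>L. 1 \<le> g (l - c))" by blast
  from bchoice[OF this] obtain g :: "'a set \<Rightarrow> 'a \<Rightarrow>\<^sub>L real"
    where g: "\<forall>L\<in>\<L>. (\<forall>k\<in>K. g L (k - c) \<le> 1) \<and> (\<forall>l\<in>L. 1 \<le> g L (l - c))" ..
  show thesis
  proof (rule that[of "g ` \<L>" V])
    show "finite (g ` \<L>)" using V(3) by (simp add: \<L>_def)
    show "f (k - c) \<le> 1" if "f \<in> g ` \<L>" "k \<in> K" for f k using g that by blast
    fix y assume y: "y \<in> V" "\<And>f. f \<in> g ` \<L> \<Longrightarrow> f (y - c) \<le> 1"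
    have "y \<in> closure K"
      unfolding closure_iff_nhds_not_empty
    proof (intro allI impI)
      fix A S assume S: "S \<subseteq> A" "open S" "y \<in> S"
      obtain t where t: "0 < t" "t < 1" "y - t *\<^sub>R (y - c) \<in> S \<inter> V"
        using small_step_in_open[of "S \<inter> V" y "y - c"] S V(1) y(1) by blast
      let ?z = "y - t *\<^sub>R (y - c)"
      obtain L where L: "L \<in> T" "?z \<in> L" using cover by blast
      have "L = K"
      proof (rule ccontr)
        assume "L \<noteq> K"
        then have "L \<in> \<L>" using L t(3) by (auto simp: \<L>_def)
        then have "1 \<le> g L (?z - c)" and le: "g L (y - c) \<le> 1" using g L(2) y(2) by blast+
        moreover have "?z - c = (1 - t) *\<^sub>R (y - c)" by (simp add: algebra_simps)
        ultimately have "1 \<le> (1 - t) * g L (y - c)" by (simp add: blinfun.scaleR_right)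
        also have "\<dots> \<le> (1 - t) * 1" using le t by (intro mult_left_mono) auto
        finally show False using t(1) by simp
      qed
      then show "K \<inter> A \<noteq> {}" using L t(3) S by blast
    qed
    then show "y \<in> K" using bodies[OF K(1)] by (simp add: convex_body_def)
  qed (use V in auto)
qed

text \<open>A single tile \<open>K\<close> gives the norm. Its intersection with its reflection in an interior
  point \<open>c\<close> is, after translation, a bounded symmetric convex body. Near a point \<open>x\<close> it
  is described by the inequalities of \<open>K\<close> near \<open>c + x\<close> together with the reflections of
  those near \<open>c - x\<close>. At a point of the unit sphere one of these inequalities must be tight, since
  otherwise the point could be moved outwards.\<close>
lemma locally_max_norm_if_locally_finite_tiling:
  fixes T :: "'a::real_normed_vector set set"
  assumes T: "tiling T" "locally_finite_in euclidean T" and bounded: "\<And>K. K \<in> T \<Longrightarrow> bounded K"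
  shows "\<exists>N :: 'a \<Rightarrow> real. equivalent_norm N \<and> locally_max N"
proof -
  obtain K where K: "K \<in> T" using T(1) by (force simp: tiling_def)
  then have body: "closed K" "convex K" "interior K \<noteq> {}" using T(1) by (auto simp: tiling_def convex_body_def)
  obtain c where c: "c \<in> interior K" using body(3) by blast
  define B where "B = {z. c + z \<in> K \<and> c - z \<in> K}"
  have "convex B"
  proof (rule convexI)
    fix x y and u v :: real assume *: "x \<in> B" "y \<in> B" "0 \<le> u" "0 \<le> v" "u + v = 1"
    have "c + (u *\<^sub>R x + v *\<^sub>R y) = u *\<^sub>R (c + x) + v *\<^sub>R (c + y)"
      "c - (u *\<^sub>R x + v *\<^sub>R y) = u *\<^sub>R (c - x) + v *\<^sub>R (c - y)"
      using scaleR_left_distrib[of u v c] *(5) by (simp_all add: algebra_simps)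
    then show "u *\<^sub>R x + v *\<^sub>R y \<in> B"
      using * convexD[OF body(2)] by (simp add: B_def)
  qed
  moreover obtain r where r: "0 < r" "ball 0 r \<subseteq> B"
  proof -
    obtain r where r: "0 < r" "ball c r \<subseteq> K" using c by (auto simp: mem_interior)
    have "ball 0 r \<subseteq> B"
    proof
      fix z :: 'a assume "z \<in> ball 0 r"
      then have "c + z \<in> ball c r" "c - z \<in> ball c r" by (auto simp: dist_norm)
      then show "z \<in> B" using r(2) by (auto simp: B_def)
    qed
    with r show ?thesis using that by blast
  qed
  ultimately have B: "convex B" "ball 0 r \<subseteq> B" "0 < r" by auto
  have "closed B"
  proof -
    have "closed ((\<lambda>z. c + z) -` K)" "closed ((\<lambda>z. c - z) -` K)"
      using body(1) by (auto intro!: closed_vimage continuous_intros)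
    then have "closed ((\<lambda>z. c + z) -` K \<inter> (\<lambda>z. c - z) -` K)" by blast
    then show ?thesis by (rule back_subst[of closed]) (auto simp: B_def)
  qed
  have "bounded B"
  proof -
    have "bounded ((\<lambda>x. x - c) ` K)" using bounded[OF K] by (rule bounded_translation_minus)
    moreover have "B \<subseteq> (\<lambda>x. x - c) ` K"
    proof
      fix z assume "z \<in> B"
      then show "z \<in> (\<lambda>x. x - c) ` K" by (intro image_eqI[of _ _ "c + z"]) (auto simp: B_def)
    qed
    ultimately show ?thesis by (rule bounded_subset)
  qed
  define N where "N = minkowski_functional B"
  have N: "equivalent_norm N"
    unfolding N_def by (rule equivalent_norm_minkowski[OF B \<open>bounded B\<close>]) (auto simp: B_def)
  have ball: "N z \<le> 1 \<longleftrightarrow> z \<in> B" for z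
    unfolding N_def by (rule minkowski_le_one_iff[OF B \<open>closed B\<close>])
  have le_N: "f y \<le> N y" if f: "\<And>z. z \<in> B \<Longrightarrow> f z \<le> 1" for f :: "'a \<Rightarrow>\<^sub>L real" and y
  proof (rule dense_ge)
    fix s assume "N y < s"
    then have "0 < s \<and> y /\<^sub>R s \<in> B" unfolding N_def by (rule minkowski_lessD[OF B])
    then show "f y \<le> s" using f[of "y /\<^sub>R s"] by (simp add: blinfun.scaleR_right field_simps)
  qed
  have "locally_max N"
  proof (rule locally_maxI[OF N])
    fix x assume x: "N x = 1"
    obtain G\<^sub>1 :: "('a \<Rightarrow>\<^sub>L real) set" and V\<^sub>1 where 1: "finite G\<^sub>1" "open V\<^sub>1" "c + x \<in> V\<^sub>1"
      "\<And>g k. g \<in> G\<^sub>1 \<Longrightarrow> k \<in> K \<Longrightarrow> g (k - c) \<le> 1"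
      "\<And>y. y \<in> V\<^sub>1 \<Longrightarrow> (\<And>g. g \<in> G\<^sub>1 \<Longrightarrow> g (y - c) \<le> 1) \<Longrightarrow> y \<in> K"
      by (rule tile_local_inequalities[OF T K c]) blast
    obtain G\<^sub>2 :: "('a \<Rightarrow>\<^sub>L real) set" and V\<^sub>2 where 2: "finite G\<^sub>2" "open V\<^sub>2" "c - x \<in> V\<^sub>2"
      "\<And>g k. g \<in> G\<^sub>2 \<Longrightarrow> k \<in> K \<Longrightarrow> g (k - c) \<le> 1"
      "\<And>y. y \<in> V\<^sub>2 \<Longrightarrow> (\<And>g. g \<in> G\<^sub>2 \<Longrightarrow> g (y - c) \<le> 1) \<Longrightarrow> y \<in> K"
      by (rule tile_local_inequalities[OF T K c]) blast
    define F where "F = G\<^sub>1 \<union> uminus ` G\<^sub>2"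
    define V where "V = (\<lambda>y. c + y) -` V\<^sub>1 \<inter> (\<lambda>y. c - y) -` V\<^sub>2"
    have F: "finite F" using 1(1) 2(1) by (simp add: F_def)
    have V: "open V" "x \<in> V"
      using 1(2,3) 2(2,3) by (auto simp: V_def intro!: open_Int open_vimage continuous_intros)
    have below: "f y \<le> N y" if "f \<in> F" for f y
    proof (rule le_N)
      fix z assume z: "z \<in> B"
      from \<open>f \<in> F\<close> consider "f \<in> G\<^sub>1" | g where "g \<in> G\<^sub>2" "f = - g" by (auto simp: F_def)
      then show "f z \<le> 1"
      proof cases
        case 1
        then show ?thesis using \<open>\<And>g k. g \<in> G\<^sub>1 \<Longrightarrow> k \<in> K \<Longrightarrow> g (k - c) \<le> 1\<close>[of f "c + z"] z by (simp add: B_def)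
      next
        case g: 2
        then show ?thesis using 2(4)[of g "c - z"] z by (simp add: B_def blinfun.minus_left blinfun.minus_right)
      qed
    qed
    have in_B: "y \<in> B" if y: "y \<in> V" "\<And>f. f \<in> F \<Longrightarrow> f y \<le> 1" for y
    proof -
      have "c + y \<in> K" using y by (intro 1(5)) (auto simp: V_def F_def)
      moreover have "c - y \<in> K"
      proof (rule 2(5))
        show "c - y \<in> V\<^sub>2" using y(1) by (simp add: V_def)
        show "g (c - y - c) \<le> 1" if "g \<in> G\<^sub>2" for g
          using y(2)[of "- g"] that by (simp add: F_def blinfun.minus_left blinfun.minus_right)
      qed
      ultimately show ?thesis by (simp add: B_def)
    qed
    have "\<exists>f\<in>F. 1 \<le> f y" if y: "y \<in> V" "N y = 1" for y
    proof (rule ccontr)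
      assume *: "\<not> (\<exists>f\<in>F. 1 \<le> f y)"
      let ?O = "V \<inter> (\<Inter>f\<in>F. {z. blinfun_apply f z < 1})"
      have "open ?O"
        using V(1) F by (intro open_Int open_INT ballI open_Collect_less continuous_intros) auto
      moreover have "y \<in> ?O" using y(1) * by (auto simp: not_le)
      ultimately obtain t where t: "0 < t" "y + t *\<^sub>R y \<in> ?O" by (rule small_step_in_open)
      then have "y + t *\<^sub>R y \<in> B" by (intro in_B) (auto intro: less_imp_le)
      moreover have "y + t *\<^sub>R y = (1 + t) *\<^sub>R y" by (simp add: algebra_simps)
      ultimately have "N ((1 + t) *\<^sub>R y) \<le> 1" using ball by simp
      then show False using t(1) y(2) by (simp add: equivalent_norm_scale[OF N])
    qed
    then show "\<exists>F V. finite (F :: ('a \<Rightarrow>\<^sub>L real) set) \<and> open V \<and> x \<in> V \<and>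
      (\<forall>f\<in>F. f x \<le> 1 \<and> (f x = 1 \<longrightarrow> (\<forall>y. f y \<le> N y))) \<and> (\<forall>y\<in>V. N y = 1 \<longrightarrow> (\<exists>f\<in>F. 1 \<le> f y))"
      using F V below x by (intro exI[of _ F] exI[of _ V]) metis
  qed
  with N show ?thesis by blast
qed

theorem theorem2:
  shows "((\<exists>T :: 'a::real_normed_vector set set.
            tiling T \<and> locally_finite_in euclidean T \<and> (\<forall>K\<in>T. bounded K))
          \<longleftrightarrow> (\<exists>N :: 'a \<Rightarrow> real. equivalent_norm N \<and> VI_polyhedral N \<and> property_Delta N))
       \<and> ((\<exists>N :: 'a \<Rightarrow> real. equivalent_norm N \<and> VI_polyhedral N \<and> property_Delta N)
          \<longleftrightarrow> (\<exists>N :: 'a \<Rightarrow> real. equivalent_norm N \<and> K_polyhedral N \<and> LFC N))"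
proof -
  have VI: "VI_polyhedral N \<and> property_Delta N \<longleftrightarrow> locally_max N" if "equivalent_norm N" for N :: "'a \<Rightarrow> real"
    using that locally_max_if_VI_Delta VI_polyhedral_if_locally_max property_Delta_if_locally_max by blast
  have K: "K_polyhedral N \<and> LFC N \<longleftrightarrow> locally_max N" if "equivalent_norm N" for N :: "'a \<Rightarrow> real"
    using that locally_max_if_K_LFC K_polyhedral_if_locally_max LFC_if_locally_max by blast
  have "(\<exists>T :: 'a set set. tiling T \<and> locally_finite_in euclidean T \<and> (\<forall>K\<in>T. bounded K))
      \<longleftrightarrow> (\<exists>N :: 'a \<Rightarrow> real. equivalent_norm N \<and> locally_max N)"
    using locally_max_norm_if_locally_finite_tiling locally_finite_tiling_if_locally_max by blast
  then show ?thesis using VI K by blast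
qed

end
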